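(* Let $G$ be a finitely generated infinite subgroup of $\mathrm{GL}_{+}(2,\mathbb{R})$ without contracting elements, and let $S$ be a tame translation surface whose Veech group is $G$ and whose ends space can be written as $\mathrm{Ends}(S)=\mathrm{Ends}_{\infty}(S)=\mathcal{B}\sqcup\mathcal{U}$, where $\mathcal{B}$ is a closed subset of $\mathrm{Ends}(S)$ homeomorphic to $\mathrm{Ends}(G)$ and $\mathcal{U}$ is a countable, discrete, dense, and open subset of $\mathrm{Ends}(S)$. Then the ends space of $S$ is one of the following. (1) If $G$ has one end, then $\mathrm{Ends}(S)$ is homeomorphic to the ordinal number $\omega+1$; in other words, $\mathrm{Ends}(S)$ is homeomorphic to the closure of $\left\{\frac1n : n\in\mathbb{N}\right\}$ in $\mathbb{R}$. (2) If $G$ has two ends, then $\mathrm{Ends}(S)$ is homeomorphic to the ordinal number $\omega\cdot 2+1$; that is, $\mathrm{Ends}(S)$ is homeomorphic to two (disjoint) copies of the closure of $\left\{\frac1n : n\in\mathbb{N}\right\}$. (3) If $G$ has infinitely many ends, then $\mathrm{Ends}(S)$ contains a subset homeomorphic to the Cantor set whose complement is a countable, discrete, dense, and open subset of $\mathrm{Ends}(S)$.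
   Context: **Groups.** $\mathrm{GL}_{+}(2,\mathbb{R})$ is the group of real $2\times 2$ matrices with positive determinant. A matrix $A\in \mathrm{GL}_{+}(2,\mathbb{R})$ is contracting if $\|Av\|<\|v\|$ for all $v\in\mathbb{R}^2\setminus\{\mathbf{0}\}$, where $\|\cdot\|$ is the Euclidean norm. A subgroup is without contracting elements if none of its elements is contracting. Ordinals carry the order topology. **Ends of a space.** Let $X$ be a locally compact, locally connected, connected, Hausdorff space. Consider infinite nested sequences $U_1\supset U_2\supset\cdots$ of non-empty connected open subsets of $X$ such that (i) each boundary $\partial U_n$ is compact, (ii) $\bigcap_{n}\overline{U_n}=\emptyset$, (iii) for every compact $K\subset X$ there is $m$ with $K\cap U_m=\emptyset$. Two such sequences $(U_n)$, $(U'_n)$ are equivalent if for each $n$ there exist $j,k$ with $U_n\supset U'_j$ and $U'_n\supset U_k$. Equivalence classes are the ends of $X$, and $\mathrm{Ends}(X)$ is the set of ends with the topology having as basis the sets $U^{*}=\{[U_n]_{n}\in \mathrm{Ends}(X) : U_j\subset U \text{ for some } j\}$, where $U$ ranges over non-empty open subsets of $X$ with compact boundary. **Ends of a group.** For a finitely generated group $G$ with a finite generating set $H$ closed under inverses, the Cayley graph $\mathrm{Cay}(G,H)$ is the geometric realization of the graph with vertex set $G$ and an edge between $g_1$ and $g_2$ if and only if $g_1h=g_2$ for some $h\in H$. One sets $\mathrm{Ends}(G):=\mathrm{Ends}(\mathrm{Cay}(G,H))$; up to homeomorphism this does not depend on the choice of $H$. The number of ends of $G$ is the cardinality of $\mathrm{Ends}(G)$;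 a finitely generated group has zero, one, two, or infinitely many ends. **Ends of a surface.** A surface is a connected 2-manifold without boundary, assumed orientable. A subsurface of $S$ is an embedded surface that is a closed subset of $S$ and whose boundary consists of finitely many disjoint simple closed curves. The genus of a surface is the supremum of the genera of its compact subsurfaces, where a compact subsurface with Euler characteristic $\chi$ and $q$ boundary curves has genus $1-\frac12(\chi+q)$. A surface is planar if it has genus zero. In the definition of the ends of a surface one may assume that the closures $\overline{U_n}$ are subsurfaces; an end $[U_n]_n$ is planar if some $\overline{U_l}$ is planar, and otherwise it has infinite genus. $\mathrm{Ends}_{\infty}(S)\subset\mathrm{Ends}(S)$ is the set of ends having infinite genus. **Translation surfaces.** A translation surface is a surface $S$ together with a maximal atlas of charts to $\mathbb{R}^2$ covering $S$ except for a subset of points $\mathrm{Sing}(S)\subset S$, such that all transition maps are locally restrictions of translations; points of $\mathrm{Sing}(S)$ are assumed non-removable (the translation atlas cannot be extended to any of them). Pulling back the Euclidean metric through the charts gives a flat Riemannian metric on $S$, and $\widehat{S}$ denotes the metric completion of $S$ for the induced distance. $S$ is tame if every $x\in\widehat{S}$ has a neighborhood $U_x\subset\widehat{S}$ isometric either to (1) some open subset of the Euclidean plane, or to (2) an open neighborhood of the ramification point of a (finite or infinite) cyclic branched covering of the unit disk in the Euclidean plane. In case (2) the point $x$ is a cone point (a finite cone angle singularity of angle $2m\pi$ if the covering has finite order $m$, an infinite cone angle singularity if the covering is infinite). **Veech group.** For a tame translation surface $S$, an affine diffeomorphism is a homeomorphism $T:\widehat{S}\to\widehat{S}$ which sends cone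 points to cone points and is an affine map in the local coordinates of the translation atlas on $S$. Let $\mathrm{Aff}_{+}(S)$ be the group of orientation-preserving affine diffeomorphisms. The differential of $T\in\mathrm{Aff}_{+}(S)$ in translation charts is a constant matrix $D(T)\in\mathrm{GL}_{+}(2,\mathbb{R})$, and $D:\mathrm{Aff}_{+}(S)\to\mathrm{GL}_{+}(2,\mathbb{R})$ is a group homomorphism. Its image $\Gamma(S)$ is the Veech group of $S$. *)

theory Defs
  imports
    "HOL-Library.Countable_Set"
    "HOL-Library.Extended_Real"
    "HOL-Complex_Analysis.Complex_Analysis"
    "HOL-Homology.Homology"
    "HOL-Algebra.Generated_Groups"
begin

section \<open>Ends of a topological space\<close>

definition end_sequence :: "'a topology \<Rightarrow> (nat \<Rightarrow> 'a set) \<Rightarrow> bool" where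
  "end_sequence X U \<longleftrightarrow>
     (\<forall>n. U n \<noteq> {} \<and> openin X (U n) \<and> connectedin X (U n) \<and> U (Suc n) \<subseteq> U n) \<and>
     (\<forall>n. compactin X (X frontier_of U n)) \<and>
     (\<Inter>n. X closure_of U n) = {} \<and>
     (\<forall>K. compactin X K \<longrightarrow> (\<exists>m. K \<inter> U m = {}))"

definition end_rel :: "'a topology \<Rightarrow> ((nat \<Rightarrow> 'a set) \<times> (nat \<Rightarrow> 'a set)) set" where
  "end_rel X = {(U, V). end_sequence X U \<and> end_sequence X V \<and>
                        (\<forall>n. \<exists>j k. V j \<subseteq> U n \<and> U k \<subseteq> V n)}"

definition ends :: "'a topology \<Rightarrow> (nat \<Rightarrow> 'a set) set set" where
  "ends X = Collect (end_sequence X) // end_rel X"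

definition ends_in :: "'a topology \<Rightarrow> 'a set \<Rightarrow> (nat \<Rightarrow> 'a set) set set" where
  "ends_in X W = {e \<in> ends X. \<exists>U\<in>e. \<exists>j. U j \<subseteq> W}"

text \<open>The sets \<^term>\<open>ends_in X W\<close> are closed under binary intersection
  (\<^prop>\<open>ends_in X V \<inter> ends_in X W = ends_in X (V \<inter> W)\<close>) and contain \<^term>\<open>ends X\<close>,
  so they form a basis of the topology they generate.\<close>

definition ends_space :: "'a topology \<Rightarrow> (nat \<Rightarrow> 'a set) set topology" where
  "ends_space X = topology_generated_by
     {ends_in X W | W. W \<noteq> {} \<and> openin X W \<and> compactin X (X frontier_of W)}"

lemma topspace_ends_space [simp]: "topspace (ends_space X) = ends X"
proof -
  have "e \<in> \<Union> {ends_in X W | W. W \<noteq> {} \<and> openin X W \<and> compactin X (X frontier_of W)}"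
    if e: "e \<in> ends X" for e
  proof -
    obtain U where U: "end_sequence X U" "e = end_rel X `` {U}"
      using e by (auto simp: ends_def elim: quotientE)
    have "U \<in> e" using U by (auto simp: end_rel_def)
    moreover have "U 0 \<subseteq> topspace X" "U 0 \<noteq> {}"
      using U openin_subset by (auto simp: end_sequence_def)
    ultimately have "e \<in> ends_in X (topspace X)" "topspace X \<noteq> {}"
      using e by (auto simp: ends_in_def)
    then show ?thesis by (auto intro!: exI[of _ "ends_in X (topspace X)"] exI[of _ "topspace X"])
  qed
  moreover have "\<Union> {ends_in X W | W. W \<noteq> {} \<and> openin X W \<and> compactin X (X frontier_of W)} \<subseteq> ends X"
    by (auto simp: ends_in_def)
  ultimately show ?thesis
    unfolding ends_space_def topology_generated_by_topspace by blast
qed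


section \<open>Groups of matrices, Cayley graphs and ends of groups\<close>

definition GL_plus :: "(real^2^2) monoid" where
  "GL_plus = \<lparr>carrier = {A. det A > 0}, monoid.mult = (**), one = mat 1\<rparr>"

lemma group_GL_plus: "group GL_plus"
proof (rule groupI)
  fix A assume A: "A \<in> carrier GL_plus"
  then have "invertible A"
    by (simp add: GL_plus_def invertible_det_nz)
  then obtain B where B: "A ** B = mat 1" "B ** A = mat 1"
    by (auto simp: invertible_def)
  have "det B * det A = 1"
    by (metis B(2) det_I det_mul)
  then have "det B > 0"
    using A by (simp add: GL_plus_def) (metis zero_less_mult_pos2 zero_less_one)
  with B show "\<exists>B\<in>carrier GL_plus. B \<otimes>\<^bsub>GL_plus\<^esub> A = \<one>\<^bsub>GL_plus\<^esub>"
    by (auto simp: GL_plus_def)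
qed (auto simp: GL_plus_def det_mul matrix_mul_assoc)

definition contracting :: "real^2^2 \<Rightarrow> bool" where
  "contracting A \<longleftrightarrow> (\<forall>v. v \<noteq> 0 \<longrightarrow> norm (A *v v) < norm v)"

definition finite_generating_set :: "('g, 'b) monoid_scheme \<Rightarrow> 'g set \<Rightarrow> bool" where
  "finite_generating_set Gr H \<longleftrightarrow>
     finite H \<and> H \<subseteq> carrier Gr \<and> (\<forall>h\<in>H. inv\<^bsub>Gr\<^esub> h \<in> H) \<and> generate Gr H = carrier Gr"

definition cayley_adjacent :: "('g, 'b) monoid_scheme \<Rightarrow> 'g set \<Rightarrow> 'g \<Rightarrow> 'g \<Rightarrow> bool" where
  "cayley_adjacent Gr H u v \<longleftrightarrow>
     u \<in> carrier Gr \<and> v \<in> carrier Gr \<and> (\<exists>h\<in>H. u \<otimes>\<^bsub>Gr\<^esub> h = v)"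

text \<open>Points of the geometric realization are given by barycentric coordinates: \<open>f\<close> is a convex
  combination of the two end points of an edge, or a single vertex (\<open>u = v\<close>). The graph is
  regarded as a simple graph, so a neutral element in \<open>H\<close> adds nothing. For finite \<open>H\<close> the graph
  is locally finite, and then the topology of pointwise convergence of the coordinates is the
  usual (weak) topology of the realization.\<close>

definition cayley_points :: "('g, 'b) monoid_scheme \<Rightarrow> 'g set \<Rightarrow> ('g \<Rightarrow> real) set" where
  "cayley_points Gr H =
     {f. \<exists>u\<in>carrier Gr. \<exists>v\<in>carrier Gr. (u = v \<or> cayley_adjacent Gr H u v) \<and>
           (\<forall>w. 0 \<le> f w) \<and> (\<forall>w. w \<notin> {u, v} \<longrightarrow> f w = 0) \<and> (\<Sum>w\<in>{u, v}. f w) = 1}"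

definition cayley_graph :: "('g, 'b) monoid_scheme \<Rightarrow> 'g set \<Rightarrow> ('g \<Rightarrow> real) topology" where
  "cayley_graph Gr H =
     subtopology (product_topology (\<lambda>_. euclideanreal) UNIV) (cayley_points Gr H)"

definition group_ends_space ::
  "('g, 'b) monoid_scheme \<Rightarrow> 'g set \<Rightarrow> (nat \<Rightarrow> ('g \<Rightarrow> real) set) set topology" where
  "group_ends_space Gr H = ends_space (cayley_graph Gr H)"


section \<open>Surfaces and their ends\<close>

definition surface :: "'a topology \<Rightarrow> bool" where
  "surface X \<longleftrightarrow>
     topspace X \<noteq> {} \<and> connected_space X \<and> Hausdorff_space X \<and> second_countable X \<and>
     (\<forall>x\<in>topspace X. \<exists>U V. openin X U \<and> x \<in> U \<and> open (V :: complex set) \<and>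
        subtopology X U homeomorphic_space top_of_set V)"

definition chart :: "'a topology \<Rightarrow> 'a set \<Rightarrow> ('a \<Rightarrow> complex) \<Rightarrow> bool" where
  "chart X U \<phi> \<longleftrightarrow>
     openin X U \<and> open (\<phi> ` U) \<and> homeomorphic_map (subtopology X U) (top_of_set (\<phi> ` U)) \<phi>"

text \<open>A homeomorphism \<open>f\<close> between open subsets of the plane preserves the orientation iff the image
  under \<open>f\<close> of a positively oriented circle around \<open>z\<close> winds once (and not \<open>-1\<close> times) around
  \<open>f z\<close>.\<close>

definition orientation_preserving_on :: "complex set \<Rightarrow> (complex \<Rightarrow> complex) \<Rightarrow> bool" where
  "orientation_preserving_on D f \<longleftrightarrow>
     (\<forall>z r. 0 < r \<and> cball z r \<subseteq> D \<longrightarrow> winding_number (f \<circ> circlepath z r) (f z) = 1)"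

definition orientable :: "'a topology \<Rightarrow> bool" where
  "orientable X \<longleftrightarrow>
     (\<exists>A. (\<forall>(U, \<phi>)\<in>A. chart X U \<phi>) \<and> (\<Union>(U, \<phi>)\<in>A. U) = topspace X \<and>
        (\<forall>(U, \<phi>)\<in>A. \<forall>(V, \<psi>)\<in>A.
           orientation_preserving_on (\<phi> ` (U \<inter> V)) (\<psi> \<circ> inv_into U \<phi>)))"

definition surface_with_boundary :: "'a topology \<Rightarrow> bool" where
  "surface_with_boundary X \<longleftrightarrow>
     topspace X \<noteq> {} \<and> connected_space X \<and> Hausdorff_space X \<and> second_countable X \<and>
     (\<forall>x\<in>topspace X. \<exists>U V. openin X U \<and> x \<in> U \<and> openin (top_of_set {z :: complex. Im z \<ge> 0}) V \<and>
        subtopology X U homeomorphic_space top_of_set V)"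

definition surface_boundary :: "'a topology \<Rightarrow> 'a set" where
  "surface_boundary X = {x \<in> topspace X. \<not> (\<exists>U V. openin X U \<and> x \<in> U \<and> open (V :: complex set) \<and>
        subtopology X U homeomorphic_space top_of_set V)}"

definition boundary_curves :: "'a topology \<Rightarrow> 'a set set" where
  "boundary_curves X = connected_components_of (subtopology X (surface_boundary X))"

definition subsurface :: "'a topology \<Rightarrow> 'a set \<Rightarrow> bool" where
  "subsurface X F \<longleftrightarrow>
     closedin X F \<and> surface_with_boundary (subtopology X F) \<and>
     finite (boundary_curves (subtopology X F)) \<and>
     (\<forall>C\<in>boundary_curves (subtopology X F).
        subtopology X C homeomorphic_space top_of_set (sphere (0 :: complex) 1))"

text \<open>The rank of an abelian group: the maximal number of elements that are linearly independent
  over the integers (used only for groups of finite rank; the value is meaningless otherwise).\<close>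

definition abelian_rank :: "('g, 'b) monoid_scheme \<Rightarrow> nat" where
  "abelian_rank Gr = Sup {card B | B. finite B \<and> B \<subseteq> carrier Gr \<and>
     (\<forall>c :: 'g \<Rightarrow> int. finprod Gr (\<lambda>b. b [^]\<^bsub>Gr\<^esub> c b) B = \<one>\<^bsub>Gr\<^esub> \<longrightarrow> (\<forall>b\<in>B. c b = 0))}"

definition betti :: "nat \<Rightarrow> 'a topology \<Rightarrow> nat" where
  "betti p X = abelian_rank (homology_group (int p) X)"

definition euler_char :: "'a topology \<Rightarrow> int" where
  "euler_char X = (\<Sum>p | betti p X \<noteq> 0. (- 1) ^ p * int (betti p X))"

definition compact_genus :: "'a topology \<Rightarrow> real" where
  "compact_genus X = 1 - (1/2) * (real_of_int (euler_char X) + real (card (boundary_curves X)))"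

definition genus :: "'a topology \<Rightarrow> ereal" where
  "genus X = Sup {ereal (compact_genus (subtopology X K)) | K. subsurface X K \<and> compactin X K}"

definition planar :: "'a topology \<Rightarrow> bool" where
  "planar X \<longleftrightarrow> genus X = 0"

definition planar_end :: "'a topology \<Rightarrow> (nat \<Rightarrow> 'a set) set \<Rightarrow> bool" where
  "planar_end X e \<longleftrightarrow>
     (\<exists>U\<in>e. (\<forall>n. subsurface X (X closure_of U n)) \<and>
             (\<exists>l. planar (subtopology X (X closure_of U l))))"

definition ends_infinite_genus :: "'a topology \<Rightarrow> (nat \<Rightarrow> 'a set) set set" where
  "ends_infinite_genus X = {e \<in> ends X. \<not> planar_end X e}"


section \<open>Translation surfaces\<close>

type_synonym 'a atlas = "('a set \<times> ('a \<Rightarrow> complex)) set"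

definition translation_compatible ::
  "'a topology \<Rightarrow> 'a set \<Rightarrow> ('a \<Rightarrow> complex) \<Rightarrow> 'a set \<Rightarrow> ('a \<Rightarrow> complex) \<Rightarrow> bool" where
  "translation_compatible X U \<phi> V \<psi> \<longleftrightarrow>
     (\<forall>x\<in>U \<inter> V. \<exists>W c. openin X W \<and> x \<in> W \<and> W \<subseteq> U \<inter> V \<and> (\<forall>w\<in>W. \<psi> w = \<phi> w + c))"

definition regular_part :: "'a atlas \<Rightarrow> 'a set" where
  "regular_part A = (\<Union>(U, \<phi>)\<in>A. U)"

definition sing :: "'a topology \<Rightarrow> 'a atlas \<Rightarrow> 'a set" where
  "sing X A = topspace X - regular_part A"

text \<open>A chart compatible with the atlas is in the atlas if it avoids the singularities
  (maximality), and no compatible chart contains a singularity (non-removability).\<close>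

definition translation_atlas :: "'a topology \<Rightarrow> 'a atlas \<Rightarrow> bool" where
  "translation_atlas X A \<longleftrightarrow>
     (\<forall>(U, \<phi>)\<in>A. chart X U \<phi>) \<and>
     (\<forall>(U, \<phi>)\<in>A. \<forall>(V, \<psi>)\<in>A. translation_compatible X U \<phi> V \<psi>) \<and>
     (\<forall>U \<phi>. chart X U \<phi> \<and> U \<subseteq> regular_part A \<and>
        (\<forall>(V, \<psi>)\<in>A. translation_compatible X U \<phi> V \<psi>) \<longrightarrow> (U, \<phi>) \<in> A) \<and>
     (\<forall>p\<in>sing X A. \<not> (\<exists>U \<phi>. p \<in> U \<and> chart X U \<phi> \<and>
        (\<forall>(V, \<psi>)\<in>A. translation_compatible X U \<phi> V \<psi>)))"

text \<open>Length of a curve for the pulled back Euclidean metric: supremum of the sums of the chord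
  lengths in charts, over finite families \<open>F\<close> of non-overlapping parameter intervals \<open>[a, b]\<close>, each
  of which is mapped into the domain of a chart \<open>\<kappa> (a, b)\<close>. The parameters at which the curve
  passes through a singularity do not contribute.\<close>

definition chord_sums :: "'a atlas \<Rightarrow> (real \<Rightarrow> 'a) \<Rightarrow> real set" where
  "chord_sums A \<gamma> =
     {(\<Sum>(a, b)\<in>F. cmod (snd (\<kappa> (a, b)) (\<gamma> b) - snd (\<kappa> (a, b)) (\<gamma> a))) | F \<kappa>.
        finite F \<and>
        (\<forall>(a, b)\<in>F. 0 \<le> a \<and> a \<le> b \<and> b \<le> 1 \<and> \<kappa> (a, b) \<in> A \<and> \<gamma> ` {a..b} \<subseteq> fst (\<kappa> (a, b))) \<and>
        pairwise (\<lambda>(a, b) (a', b'). b \<le> a' \<or> b' \<le> a) F}"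

definition flat_length :: "'a atlas \<Rightarrow> (real \<Rightarrow> 'a) \<Rightarrow> ereal" where
  "flat_length A \<gamma> = Sup (ereal ` chord_sums A \<gamma>)"

definition flat_edist :: "'a topology \<Rightarrow> 'a atlas \<Rightarrow> 'a \<Rightarrow> 'a \<Rightarrow> ereal" where
  "flat_edist X A x y = Inf {flat_length A \<gamma> | \<gamma>.
     pathin X \<gamma> \<and> \<gamma> 0 = x \<and> \<gamma> 1 = y \<and> finite {t \<in> {0..1}. \<gamma> t \<in> sing X A}}"

definition flat_dist :: "'a topology \<Rightarrow> 'a atlas \<Rightarrow> 'a \<Rightarrow> 'a \<Rightarrow> real" where
  "flat_dist X A x y = real_of_ereal (flat_edist X A x y)"

definition translation_surface :: "'a topology \<Rightarrow> 'a atlas \<Rightarrow> bool" where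
  "translation_surface X A \<longleftrightarrow>
     surface X \<and> orientable X \<and> translation_atlas X A \<and>
     (\<forall>x\<in>topspace X. \<forall>y\<in>topspace X. flat_edist X A x y \<noteq> \<infinity>) \<and>
     Metric_space (topspace X) (flat_dist X A) \<and>
     Metric_space.mtopology (topspace X) (flat_dist X A) = X"


subsection \<open>Metric completion\<close>

definition cauchy_rel :: "'a set \<Rightarrow> ('a \<Rightarrow> 'a \<Rightarrow> real) \<Rightarrow> ((nat \<Rightarrow> 'a) \<times> (nat \<Rightarrow> 'a)) set" where
  "cauchy_rel M d = {(\<sigma>, \<tau>). Metric_space.MCauchy M d \<sigma> \<and> Metric_space.MCauchy M d \<tau> \<and>
                             (\<lambda>n. d (\<sigma> n) (\<tau> n)) \<longlonglongrightarrow> 0}"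

definition completion_points :: "'a set \<Rightarrow> ('a \<Rightarrow> 'a \<Rightarrow> real) \<Rightarrow> (nat \<Rightarrow> 'a) set set" where
  "completion_points M d = Collect (Metric_space.MCauchy M d) // cauchy_rel M d"

definition completion_dist ::
  "'a set \<Rightarrow> ('a \<Rightarrow> 'a \<Rightarrow> real) \<Rightarrow> (nat \<Rightarrow> 'a) set \<Rightarrow> (nat \<Rightarrow> 'a) set \<Rightarrow> real" where
  "completion_dist M d p q =
     (if p \<in> completion_points M d \<and> q \<in> completion_points M d
      then lim (\<lambda>n. d ((SOME \<sigma>. \<sigma> \<in> p) n) ((SOME \<tau>. \<tau> \<in> q) n)) else 0)"

definition completion_embed :: "'a set \<Rightarrow> ('a \<Rightarrow> 'a \<Rightarrow> real) \<Rightarrow> 'a \<Rightarrow> (nat \<Rightarrow> 'a) set" where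
  "completion_embed M d x = cauchy_rel M d `` {\<lambda>n. x}"

definition hat_points :: "'a topology \<Rightarrow> 'a atlas \<Rightarrow> (nat \<Rightarrow> 'a) set set" where
  "hat_points X A = completion_points (topspace X) (flat_dist X A)"

definition hat_dist :: "'a topology \<Rightarrow> 'a atlas \<Rightarrow> (nat \<Rightarrow> 'a) set \<Rightarrow> (nat \<Rightarrow> 'a) set \<Rightarrow> real" where
  "hat_dist X A = completion_dist (topspace X) (flat_dist X A)"

definition hat_topology :: "'a topology \<Rightarrow> 'a atlas \<Rightarrow> (nat \<Rightarrow> 'a) set topology" where
  "hat_topology X A = Metric_space.mtopology (hat_points X A) (hat_dist X A)"

definition hat_embed :: "'a topology \<Rightarrow> 'a atlas \<Rightarrow> 'a \<Rightarrow> (nat \<Rightarrow> 'a) set" where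
  "hat_embed X A = completion_embed (topspace X) (flat_dist X A)"


subsection \<open>Cone points and tameness\<close>

definition covering_atlas :: "'c topology \<Rightarrow> ('c \<Rightarrow> complex) \<Rightarrow> 'c atlas" where
  "covering_atlas Y p = {(U, \<phi>). chart Y U \<phi> \<and> (\<exists>c. \<forall>w\<in>U. \<phi> w = p w + c)}"

text \<open>The cyclic branched covering of order \<open>m\<close> of the unit disk is \<open>z \<mapsto> z^m\<close> on the unit disk, with
  ramification point \<open>0\<close>. The infinite one is \<open>exp\<close> on the left half plane (the universal covering
  of the punctured disk), together with a ramification point \<open>None\<close> above \<open>0\<close>. Both carry the
  distance of the pulled back Euclidean metric.\<close>

definition finite_cone_dist :: "nat \<Rightarrow> complex \<Rightarrow> complex \<Rightarrow> real" where
  "finite_cone_dist m =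
     flat_dist (top_of_set (ball 0 1)) (covering_atlas (top_of_set (ball 0 1)) (\<lambda>z. z ^ m))"

definition left_half_plane :: "complex set" where
  "left_half_plane = {w. Re w < 0}"

definition infinite_cone_points :: "complex option set" where
  "infinite_cone_points = insert None (Some ` left_half_plane)"

fun infinite_cone_dist :: "complex option \<Rightarrow> complex option \<Rightarrow> real" where
  "infinite_cone_dist None None = 0"
| "infinite_cone_dist None (Some w) = cmod (exp w)"
| "infinite_cone_dist (Some w) None = cmod (exp w)"
| "infinite_cone_dist (Some v) (Some w) =
     flat_dist (top_of_set left_half_plane) (covering_atlas (top_of_set left_half_plane) exp) v w"

definition isometric_near ::
  "'a set \<Rightarrow> ('a \<Rightarrow> 'a \<Rightarrow> real) \<Rightarrow> 'a \<Rightarrow> 'c set \<Rightarrow> ('c \<Rightarrow> 'c \<Rightarrow> real) \<Rightarrow> 'c \<Rightarrow> bool" where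
  "isometric_near M d x N e y \<longleftrightarrow>
     (\<exists>U f. openin (Metric_space.mtopology M d) U \<and> x \<in> U \<and> f x = y \<and>
            openin (Metric_space.mtopology N e) (f ` U) \<and>
            (\<forall>a\<in>U. \<forall>b\<in>U. e (f a) (f b) = d a b))"

definition flat_point :: "'a topology \<Rightarrow> 'a atlas \<Rightarrow> (nat \<Rightarrow> 'a) set \<Rightarrow> bool" where
  "flat_point X A x \<longleftrightarrow> (\<exists>y. isometric_near (hat_points X A) (hat_dist X A) x (UNIV :: complex set) dist y)"

text \<open>Order \<open>m = 1\<close> is excluded, since it gives the Euclidean disk, that is, a flat point.\<close>

definition cone_point :: "'a topology \<Rightarrow> 'a atlas \<Rightarrow> (nat \<Rightarrow> 'a) set \<Rightarrow> bool" where
  "cone_point X A x \<longleftrightarrow>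
     (\<exists>m\<ge>2. isometric_near (hat_points X A) (hat_dist X A) x (ball 0 1) (finite_cone_dist m) 0) \<or>
     isometric_near (hat_points X A) (hat_dist X A) x infinite_cone_points infinite_cone_dist None"

definition tame :: "'a topology \<Rightarrow> 'a atlas \<Rightarrow> bool" where
  "tame X A \<longleftrightarrow> (\<forall>x\<in>hat_points X A. flat_point X A x \<or> cone_point X A x)"

definition cone_points :: "'a topology \<Rightarrow> 'a atlas \<Rightarrow> (nat \<Rightarrow> 'a) set set" where
  "cone_points X A = {x \<in> hat_points X A. cone_point X A x}"


subsection \<open>Affine diffeomorphisms and the Veech group\<close>

definition plane_map :: "real^2^2 \<Rightarrow> complex \<Rightarrow> complex" where
  "plane_map M z = (let v = M *v vector [Re z, Im z] in Complex (v $ 1) (v $ 2))"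

text \<open>\<open>T\<close> is affine near \<open>x\<close> with linear part \<open>M\<close>, in all translation charts around \<open>x\<close> and around
  \<open>T x\<close>. There is no condition if \<open>T x\<close> is not a regular point of the surface.\<close>

definition affine_near ::
  "'a topology \<Rightarrow> 'a atlas \<Rightarrow> ((nat \<Rightarrow> 'a) set \<Rightarrow> (nat \<Rightarrow> 'a) set) \<Rightarrow> 'a \<Rightarrow> real^2^2 \<Rightarrow> bool" where
  "affine_near X A T x M \<longleftrightarrow>
     (\<forall>(U, \<phi>)\<in>A. \<forall>(V, \<psi>)\<in>A. x \<in> U \<and> T (hat_embed X A x) \<in> hat_embed X A ` V \<longrightarrow>
        (\<exists>W b. openin X W \<and> x \<in> W \<and> W \<subseteq> U \<and>
           (\<forall>w\<in>W. \<exists>v\<in>V. T (hat_embed X A w) = hat_embed X A v \<and> \<psi> v = plane_map M (\<phi> w) + b)))"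

definition affine_diffeo :: "'a topology \<Rightarrow> 'a atlas \<Rightarrow> ((nat \<Rightarrow> 'a) set \<Rightarrow> (nat \<Rightarrow> 'a) set) \<Rightarrow> bool" where
  "affine_diffeo X A T \<longleftrightarrow>
     homeomorphic_map (hat_topology X A) (hat_topology X A) T \<and>
     T ` cone_points X A = cone_points X A \<and>
     (\<forall>x\<in>regular_part A. \<exists>M. affine_near X A T x M)"

definition has_differential ::
  "'a topology \<Rightarrow> 'a atlas \<Rightarrow> ((nat \<Rightarrow> 'a) set \<Rightarrow> (nat \<Rightarrow> 'a) set) \<Rightarrow> real^2^2 \<Rightarrow> bool" where
  "has_differential X A T M \<longleftrightarrow> (\<forall>x\<in>regular_part A. affine_near X A T x M)"

text \<open>An affine diffeomorphism preserves the orientation iff its differential has positive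
  determinant.\<close>

definition veech_group :: "'a topology \<Rightarrow> 'a atlas \<Rightarrow> (real^2^2) set" where
  "veech_group X A = {M. \<exists>T. affine_diffeo X A T \<and> has_differential X A T M \<and> det M > 0}"


section \<open>Model spaces\<close>

text \<open>A pair \<open>(a, n)\<close> of natural numbers, ordered lexicographically, stands for the ordinal
  \<open>\<omega> \<cdot> a + n\<close>; every ordinal below \<open>\<omega>^2\<close> is the set of its predecessors among these.\<close>

definition ordinal_less :: "(nat \<times> nat) rel" where
  "ordinal_less = less_than <*lex*> less_than"

definition ordinal_set :: "nat \<times> nat \<Rightarrow> (nat \<times> nat) set" where
  "ordinal_set \<alpha> = {\<beta>. (\<beta>, \<alpha>) \<in> ordinal_less}"

definition ordinal_space :: "nat \<times> nat \<Rightarrow> (nat \<times> nat) topology" where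
  "ordinal_space \<alpha> = topology_generated_by
     ({ordinal_set \<alpha>} \<union>
      {{\<beta> \<in> ordinal_set \<alpha>. (\<beta>, \<delta>) \<in> ordinal_less} | \<delta>. \<delta> \<in> ordinal_set \<alpha>} \<union>
      {{\<beta> \<in> ordinal_set \<alpha>. (\<delta>, \<beta>) \<in> ordinal_less} | \<delta>. \<delta> \<in> ordinal_set \<alpha>})"

definition omega_plus_1 :: "(nat \<times> nat) topology" where
  "omega_plus_1 = ordinal_space (1, 1)"

definition omega_times_2_plus_1 :: "(nat \<times> nat) topology" where
  "omega_times_2_plus_1 = ordinal_space (2, 1)"

definition harmonic_closure :: "real topology" where
  "harmonic_closure = top_of_set (closure {1 / real n | n. n \<ge> 1})"

fun cantor_step :: "nat \<Rightarrow> real set" where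
  "cantor_step 0 = {0..1}"
| "cantor_step (Suc n) = (\<lambda>x. x / 3) ` cantor_step n \<union> (\<lambda>x. 2 / 3 + x / 3) ` cantor_step n"

definition cantor_set :: "real set" where
  "cantor_set = (\<Inter>n. cantor_step n)"

definition countable_discrete_dense_open :: "'a topology \<Rightarrow> 'a set \<Rightarrow> bool" where
  "countable_discrete_dense_open X U \<longleftrightarrow>
     U \<subseteq> topspace X \<and> countable U \<and> subtopology X U = discrete_topology U \<and>
     X closure_of U = topspace X \<and> openin X U"

end

theory Submission
  imports Defs
begin

text \<open>
  The surface \<open>S\<close> is a connected, locally connected Hausdorff space with an
  exhaustion by compact sets \<open>K n\<close>, each inside the interior of the next. In such a space an end is
  the same as a decreasing sequence of components of the complements of the \<open>K n\<close>, and only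
  finitely many components of the complement of \<open>K n\<close> leave \<open>K (Suc n)\<close>. The space of ends is thus an
  inverse limit of finite sets. Concretely, Koenig's lemma on the tree of components
  (\<open>ends_in_cover\<close>) makes it compact (\<open>compact_ends_space\<close>), and the ends that lie in a given
  component form a clopen set, so that there is a countable clopen base
  (\<open>countable_clopen_base_ends\<close>).

  The Cayley graph of an infinite finitely generated group is a space of the same kind, exhausted by
  the subgraphs on balls in the word metric. A suitable left translation carries any such ball off a
  given ball and into a given unbounded component of the complement of the latter. The classical argument of Freudenthal and
  Hopf then shows that as soon as there are three ends, no end is isolated
  (\<open>three_ends_imp_perfect\<close>): an isolated end would have a neighbourhood into which a translate of
  a ball separating three ends fits, and at least two of the separated pieces would stay inside that
  neighbourhood. So the number of ends of the group is one, two or infinite, and in the last case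
  the ends space is a nonempty compact Hausdorff space with a countable clopen base and without
  isolated points, that is, a Cantor set (\<open>homeomorphic_cantor_set\<close>).

  Now let \<open>Ends(S) = B \<union> U\<close> be as in the theorem. If the group has infinitely many ends, \<open>B\<close> itself is
  the Cantor set looked for. If \<open>B\<close> is finite, then the points of \<open>U\<close> are isolated and can accumulate
  at \<open>B\<close> only, and by density they do accumulate at every point of \<open>B\<close>. Distributing \<open>U\<close> among the
  points of \<open>B\<close> by means of disjoint neighbourhoods exhibits \<open>Ends(S)\<close> as a disjoint union of as many
  convergent sequences as \<open>B\<close> has points. Such a space is unique up to homeomorphism
  (\<open>homeomorphic_convergent_sequences\<close>), and all of the model spaces are of this form.
\<close>

section \<open>The topology on the space of ends\<close>

lemma end_sequence_antimono:
  assumes "end_sequence X U" "m \<le> n" shows "U n \<subseteq> U m"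
  using assms(2) by (rule lift_Suc_antimono_le[rotated]) (use assms(1) in \<open>auto simp: end_sequence_def\<close>)

lemma equiv_end_rel: "equiv (Collect (end_sequence X)) (end_rel X)"
proof (rule equivI)
  show "refl_on (Collect (end_sequence X)) (end_rel X)"
    by (auto simp: refl_on_def end_rel_def)
  show "sym (end_rel X)"
    unfolding sym_def end_rel_def by blast
  show "trans (end_rel X)"
  proof (rule transI)
    fix U V W assume "(U, V) \<in> end_rel X" "(V, W) \<in> end_rel X"
    then have a: "end_sequence X U" "end_sequence X W" "\<And>n. \<exists>j. V j \<subseteq> U n" "\<And>n. \<exists>j. W j \<subseteq> V n"
      "\<And>n. \<exists>j. V j \<subseteq> W n" "\<And>n. \<exists>j. U j \<subseteq> V n" by (auto simp: end_rel_def)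
    then have "\<exists>j. W j \<subseteq> U n" "\<exists>j. U j \<subseteq> W n" for n by (meson subset_trans)+
    then show "(U, W) \<in> end_rel X" using a(1,2) by (simp add: end_rel_def)
  qed
qed (auto simp: end_rel_def)

lemma ends_representative:
  assumes "e \<in> ends X" obtains U where "U \<in> e" "end_sequence X U"
  using assms equiv_end_rel[of X]
  by (metis ends_def equiv_Eps_in equiv_Eps_preserves mem_Collect_eq)

lemma end_class:
  assumes "end_sequence X U"
  shows "end_rel X `` {U} \<in> ends X" "U \<in> end_rel X `` {U}"
  using assms by (auto simp: ends_def quotient_def end_rel_def)

lemma ends_mem_end_rel:
  assumes "e \<in> ends X" "U \<in> e" "V \<in> e" shows "(U, V) \<in> end_rel X"
  using assms unfolding ends_def by (meson equiv_end_rel quotient_eq_iff)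

lemma ends_eqI:
  assumes "e \<in> ends X" "e' \<in> ends X" "U \<in> e" "V \<in> e'" "(U, V) \<in> end_rel X"
  shows "e = e'"
  using assms unfolding ends_def by (meson equiv_end_rel quotient_eq_iff)

text \<open>Whether an end lies in \<open>W\<close> can be tested on any one of its representatives, because
  equivalent sequences are cofinal in each other.\<close>

lemma ends_in_iff:
  assumes "e \<in> ends X" "U \<in> e"
  shows "e \<in> ends_in X W \<longleftrightarrow> (\<exists>j. U j \<subseteq> W)"
proof
  assume "e \<in> ends_in X W"
  then obtain V j where V: "V \<in> e" "V j \<subseteq> W" by (auto simp: ends_in_def)
  then have "(U, V) \<in> end_rel X" using ends_mem_end_rel[OF assms] by blast
  then show "\<exists>j. U j \<subseteq> W" using V by (fastforce simp: end_rel_def)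
qed (use assms in \<open>auto simp: ends_in_def\<close>)

lemma ends_in_mono: "V \<subseteq> W \<Longrightarrow> ends_in X V \<subseteq> ends_in X W"
  unfolding ends_in_def by blast

lemma ends_in_Int: "ends_in X (V \<inter> W) = ends_in X V \<inter> ends_in X W"
proof
  show "ends_in X V \<inter> ends_in X W \<subseteq> ends_in X (V \<inter> W)"
  proof
    fix e assume e: "e \<in> ends_in X V \<inter> ends_in X W"
    then have E: "e \<in> ends X" by (auto simp: ends_in_def)
    then obtain U where U: "U \<in> e" "end_sequence X U" by (rule ends_representative)
    obtain i j where "U i \<subseteq> V" "U j \<subseteq> W" using e ends_in_iff[OF E U(1)] by auto
    then have "U (max i j) \<subseteq> V \<inter> W"
      using end_sequence_antimono[OF U(2), of i "max i j"] end_sequence_antimono[OF U(2), of j "max i j"]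
      by auto
    then show "e \<in> ends_in X (V \<inter> W)" using ends_in_iff[OF E U(1)] by blast
  qed
qed (intro Int_greatest ends_in_mono Int_lower1 Int_lower2)

lemma ends_in_empty [simp]: "ends_in X {} = {}"
proof -
  { fix e assume e: "e \<in> ends_in X {}"
    then have E: "e \<in> ends X" by (auto simp: ends_in_def)
    then obtain U where U: "U \<in> e" "end_sequence X U" by (rule ends_representative)
    then have False using e ends_in_iff[OF E U(1)] by (auto simp: end_sequence_def) }
  then show ?thesis by blast
qed

lemma ends_in_topspace: "ends_in X (topspace X) = ends X"
proof -
  { fix e assume E: "e \<in> ends X"
    then obtain U where U: "U \<in> e" "end_sequence X U" by (rule ends_representative)
    then have "U 0 \<subseteq> topspace X" using openin_subset by (auto simp: end_sequence_def)
    then have "e \<in> ends_in X (topspace X)" using ends_in_iff[OF E U(1)] by blast }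
  then show ?thesis by (auto simp: ends_in_def)
qed

lemma ends_in_disjoint: "V \<inter> W = {} \<Longrightarrow> ends_in X V \<inter> ends_in X W = {}"
  by (metis ends_in_Int ends_in_empty)

text \<open>Used throughout for the tails of an end: they are connected and eventually leave every
  compact frontier behind, so that eventually they are on one side of it.\<close>

lemma connectedin_avoids_frontier:
  assumes "connectedin X C" "C \<inter> X frontier_of W = {}"
  shows "C \<subseteq> W \<or> C \<inter> W = {}"
  using connectedin_Int_frontier_of[OF assms(1)] assms(2) by blast

text \<open>A tail that avoids the compact frontier of \<open>W\<close> lies inside \<open>W\<close> or outside its closure. This is
  what makes the basic open sets of the ends space closed as well.\<close>

lemma ends_Diff_ends_in:
  assumes "compactin X (X frontier_of W)"
  shows "ends X - ends_in X W = ends_in X (topspace X - X closure_of W)"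
proof -
  have "e \<in> ends_in X W \<or> e \<in> ends_in X (topspace X - X closure_of W)" if E: "e \<in> ends X" for e
  proof -
    obtain U where U: "U \<in> e" "end_sequence X U" using E by (rule ends_representative)
    obtain m where m: "X frontier_of W \<inter> U m = {}" using assms U(2) by (auto simp: end_sequence_def)
    have op: "openin X (U m)" "connectedin X (U m)" using U(2) by (auto simp: end_sequence_def)
    from m op(2) consider "U m \<subseteq> W" | "U m \<inter> W = {}"
      using connectedin_avoids_frontier[of X "U m" W] by blast
    then show ?thesis
    proof cases
      case 2
      then have "U m \<inter> X closure_of W = {}" using op(1) by (simp add: openin_Int_closure_of_eq_empty)
      then have "U m \<subseteq> topspace X - X closure_of W" using openin_subset[OF op(1)] by blast
      then show ?thesis using ends_in_iff[OF E U(1)] by blast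
    qed (use ends_in_iff[OF E U(1)] in blast)
  qed
  moreover have "ends_in X W \<inter> ends_in X (topspace X - X closure_of W) = {}"
  proof -
    have "ends_in X W = ends_in X (W \<inter> topspace X)"
      unfolding ends_in_Int ends_in_topspace by (auto simp: ends_in_def)
    moreover have "(W \<inter> topspace X) \<inter> (topspace X - X closure_of W) = {}"
      using closure_of_subset_Int by fastforce
    ultimately show ?thesis using ends_in_disjoint by metis
  qed
  ultimately show ?thesis by (auto simp: ends_in_def)
qed

lemma openin_ends_in:
  assumes "openin X W" "compactin X (X frontier_of W)"
  shows "openin (ends_space X) (ends_in X W)"
proof (cases "W = {}")
  case False
  then show ?thesis unfolding ends_space_def using assms by (blast intro: topology_generated_by_Basis)
qed simp

lemma closedin_ends_in:
  assumes "openin X W" "compactin X (X frontier_of W)"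
  shows "closedin (ends_space X) (ends_in X W)"
proof -
  have "X frontier_of (topspace X - X closure_of W) \<subseteq> X frontier_of W"
    unfolding frontier_of_complement
    unfolding frontier_of_def closure_of_closure_of
    by (intro Diff_mono order_refl interior_of_mono closure_of_subset openin_subset assms(1))
  then have "compactin X (X frontier_of (topspace X - X closure_of W))"
    using assms(2) closed_compactin closedin_frontier_of by blast
  then have "openin (ends_space X) (ends X - ends_in X W)"
    unfolding ends_Diff_ends_in[OF assms(2)] by (auto intro!: openin_ends_in)
  then show ?thesis by (auto simp: closedin_def ends_in_def)
qed

text \<open>The generating sets are a base and not merely a subbase, since the sets with compact frontier
  are closed under binary intersection.\<close>

lemma openin_ends_space_base:
  assumes "openin (ends_space X) F" "e \<in> F"
  shows "\<exists>W. openin X W \<and> compactin X (X frontier_of W) \<and> e \<in> ends_in X W \<and> ends_in X W \<subseteq> F"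
proof -
  have "generate_topology_on {ends_in X W | W. W \<noteq> {} \<and> openin X W \<and> compactin X (X frontier_of W)} F"
    using assms(1) unfolding ends_space_def openin_topology_generated_by_iff .
  then show ?thesis using assms(2)
  proof (induction arbitrary: e)
    case (Int a b)
    obtain V where V: "openin X V" "compactin X (X frontier_of V)" "e \<in> ends_in X V" "ends_in X V \<subseteq> a"
      using Int.IH(1)[of e] Int.prems by blast
    obtain W where W: "openin X W" "compactin X (X frontier_of W)" "e \<in> ends_in X W" "ends_in X W \<subseteq> b"
      using Int.IH(2)[of e] Int.prems by blast
    have "compactin X (X frontier_of (V \<inter> W))"
      using closed_compactin[OF compactin_Un[OF V(2) W(2)] frontier_of_Int_subset closedin_frontier_of] .
    then show ?case using V W by (intro exI[of _ "V \<inter> W"]) (auto simp: ends_in_Int)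
  next
    case (UN K)
    then obtain k where "k \<in> K" "e \<in> k" by blast
    then show ?case using UN.IH[of k e] by blast
  qed auto
qed

text \<open>If two representatives are not equivalent, then some member \<open>U n\<close> of one of them contains no
  member of the other. The clopen set of the ends in \<open>U n\<close> then separates the two ends.\<close>

lemma Hausdorff_ends_space: "Hausdorff_space (ends_space X)"
proof -
  have sep: "\<exists>F F'. openin (ends_space X) F \<and> openin (ends_space X) F' \<and> e \<in> F \<and> e' \<in> F' \<and> disjnt F F'"
    if e: "e \<in> ends X" "e' \<in> ends X" "U \<in> e" and U: "end_sequence X U" and nosub: "e' \<notin> ends_in X (U n)"
    for e e' U n
  proof -
    have W: "openin X (U n)" "compactin X (X frontier_of (U n))" using U by (auto simp: end_sequence_def)
    have "e \<in> ends_in X (U n)" using e by (auto simp: ends_in_iff)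
    then show ?thesis
      using nosub e openin_ends_in[OF W] closedin_ends_in[OF W]
      by (intro exI[of _ "ends_in X (U n)"] exI[of _ "ends X - ends_in X (U n)"])
         (auto simp: closedin_def disjnt_def)
  qed
  show ?thesis unfolding Hausdorff_space_def topspace_ends_space
  proof (intro allI impI)
    fix e e' assume e: "e \<in> ends X \<and> e' \<in> ends X \<and> e \<noteq> e'"
    obtain U where U: "U \<in> e" "end_sequence X U" using e ends_representative by blast
    obtain V where V: "V \<in> e'" "end_sequence X V" using e ends_representative by blast
    have "(U, V) \<notin> end_rel X" using ends_eqI[of e X e' U V] U V e by blast
    then obtain n where "(\<forall>j. \<not> V j \<subseteq> U n) \<or> (\<forall>j. \<not> U j \<subseteq> V n)" using U V by (auto simp: end_rel_def)
    then have "e' \<notin> ends_in X (U n) \<or> e \<notin> ends_in X (V n)"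
      using ends_in_iff[of e X U] ends_in_iff[of e' X V] U V e by blast
    then show "\<exists>F F'. openin (ends_space X) F \<and> openin (ends_space X) F' \<and> e \<in> F \<and> e' \<in> F' \<and> disjnt F F'"
      using sep[of e e' U n] sep[of e' e V n] e U V by (metis disjnt_sym)
  qed
qed

section \<open>Ends of spaces with a compact exhaustion\<close>

text \<open>The sets \<open>K n\<close> are cofinal among the compact sets (\<open>compactin_subset_K\<close> below), so that the ends
  can be read off from the components of their complements.\<close>

locale exhausted_space =
  fixes X :: "'a topology" and K :: "nat \<Rightarrow> 'a set"
  assumes Hausdorff: "Hausdorff_space X"
    and locally_connected: "locally_connected_space X"
    and connected: "connected_space X"
    and compactin_K: "compactin X (K n)"
    and K_subset_interior: "K n \<subseteq> X interior_of K (Suc n)"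
    and Union_K: "(\<Union>n. K n) = topspace X"
begin

definition comps :: "nat \<Rightarrow> 'a set set" where
  "comps n = connected_components_of (subtopology X (topspace X - K n))"

lemma K_mono: "m \<le> n \<Longrightarrow> K m \<subseteq> K n"
  by (rule lift_Suc_mono_le) (meson K_subset_interior interior_of_subset subset_trans)

lemma K_subset_topspace: "K n \<subseteq> topspace X"
  using Union_K by blast

lemma closedin_K: "closedin X (K n)"
  by (rule compactin_imp_closedin[OF Hausdorff compactin_K])

lemma openin_Diff_K: "openin X (topspace X - K n)"
  by (simp add: closedin_K openin_diff)

lemma compactin_subset_K:
  assumes "compactin X L" shows "\<exists>n. L \<subseteq> K n"
proof -
  have "L \<subseteq> (\<Union>n. X interior_of K (Suc n))"
    using compactin_subset_topspace[OF assms] Union_K K_subset_interior by blast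
  then obtain \<F> where F: "finite \<F>" "\<F> \<subseteq> range (\<lambda>n. X interior_of K (Suc n))" "L \<subseteq> \<Union>\<F>"
    using assms unfolding compactin_def by (metis (no_types, lifting) imageE openin_interior_of)
  then obtain I where I: "finite I" "\<F> = (\<lambda>n. X interior_of K (Suc n)) ` I"
    by (meson finite_subset_image)
  have "X interior_of K (Suc i) \<subseteq> K (Suc (Max I))" if "i \<in> I" for i
    using K_mono[of "Suc i" "Suc (Max I)"] interior_of_subset[of X "K (Suc i)"] that I(1) by auto
  then show ?thesis using F(3) I(2) by blast
qed

lemma comps_props:
  assumes "C \<in> comps n"
  shows openin_comps: "openin X C" and connectedin_comps: "connectedin X C"
    and comps_nonempty: "C \<noteq> {}" and comps_disjoint_K: "C \<inter> K n = {}"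
proof -
  show "openin X C"
    using assms locally_connected openin_Diff_K unfolding comps_def
    by (meson locally_connected_space_open_connected_components)
  show "connectedin X C"
    using connectedin_connected_components_of[of C "subtopology X (topspace X - K n)"] assms
    by (simp add: comps_def connectedin_subtopology)
  show "C \<noteq> {}" using assms nonempty_connected_components_of unfolding comps_def by blast
  show "C \<inter> K n = {}"
    using connected_components_of_subset[of C "subtopology X (topspace X - K n)"] assms
    by (auto simp: comps_def)
qed

lemma comps_maximal:
  assumes "C \<in> comps n" "connectedin X S" "S \<inter> K n = {}" "S \<inter> C \<noteq> {}"
  shows "S \<subseteq> C"
proof -
  have "connectedin (subtopology X (topspace X - K n)) S"
    using assms(2,3) connectedin_subset_topspace[OF assms(2)] by (auto simp: connectedin_subtopology)
  then show ?thesis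
    using connected_components_of_maximal[of C _ S] assms(1,4) unfolding comps_def disjnt_def by blast
qed

lemma comps_disjoint: "C \<in> comps n \<Longrightarrow> D \<in> comps n \<Longrightarrow> C \<noteq> D \<Longrightarrow> C \<inter> D = {}"
  by (metis comps_disjoint_K comps_maximal connectedin_comps inf_commute subset_antisym)

lemma Union_comps: "\<Union>(comps n) = topspace X - K n"
  unfolding comps_def Union_connected_components_of by auto

lemma connectedin_subset_comp:
  assumes "connectedin X S" "S \<inter> K n = {}" "S \<noteq> {}"
  shows "\<exists>C\<in>comps n. S \<subseteq> C"
proof -
  obtain x where "x \<in> S" using assms(3) by blast
  then have "x \<in> \<Union>(comps n)"
    unfolding Union_comps using assms(2) connectedin_subset_topspace[OF assms(1)] by blast
  then show ?thesis using comps_maximal[OF _ assms(1,2)] \<open>x \<in> S\<close> by blast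
qed

lemma frontier_of_comps:
  assumes "C \<in> comps n" shows "X frontier_of C \<subseteq> K n"
proof
  fix x assume x: "x \<in> X frontier_of C"
  then have xC: "x \<in> X closure_of C" "x \<notin> C" using frontier_of_openin[OF openin_comps[OF assms]] by auto
  show "x \<in> K n"
  proof (rule ccontr)
    assume "x \<notin> K n"
    then have "x \<in> \<Union>(comps n)" using x frontier_of_subset_topspace unfolding Union_comps by fastforce
    then obtain D where D: "D \<in> comps n" "x \<in> D" by blast
    then have "D \<inter> C = {}" using comps_disjoint assms xC by blast
    then show False using D xC openin_Int_closure_of_eq_empty[OF openin_comps[OF D(1)], of C] by blast
  qed
qed

lemma compactin_frontier_of_comps: "C \<in> comps n \<Longrightarrow> compactin X (X frontier_of C)"
  by (meson closed_compactin closedin_frontier_of compactin_K frontier_of_comps)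

text \<open>A component that leaves \<open>K (Suc n)\<close> has to cross its frontier, unless it is the whole space. The
  frontier is compact and is covered by the components of the complement of \<open>K n\<close>, which are open
  and disjoint, so it meets only finitely many of them.\<close>

lemma finite_unbounded_comps: "finite {C \<in> comps n. \<not> C \<subseteq> K (Suc n)}"
proof -
  let ?F = "X frontier_of K (Suc n)"
  have F: "compactin X ?F" "?F \<inter> K n = {}"
    using closed_compactin[OF compactin_K frontier_of_subset_closedin[OF closedin_K] closedin_frontier_of]
      K_subset_interior[of n] by (auto simp: frontier_of_def)
  have "?F \<subseteq> \<Union>(comps n)"
    using F(2) frontier_of_subset_topspace unfolding Union_comps by fastforce
  then obtain \<F> where \<F>: "finite \<F>" "\<F> \<subseteq> comps n" "?F \<subseteq> \<Union>\<F>"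
    using F(1) openin_comps unfolding compactin_def by meson
  have "C \<in> insert (topspace X) \<F>" if C: "C \<in> comps n" "\<not> C \<subseteq> K (Suc n)" for C
  proof (cases "C \<inter> K (Suc n) = {}")
    case True
    \<comment> \<open>Then the closure of \<open>C\<close> misses the interior of \<open>K (Suc n)\<close>, which contains the frontier of \<open>C\<close>.\<close>
    have "X frontier_of C \<subseteq> X interior_of K (Suc n)" using frontier_of_comps[OF C(1)] K_subset_interior by blast
    moreover have "X interior_of K (Suc n) \<inter> X closure_of C = {}"
      using True interior_of_subset[of X "K (Suc n)"]
      by (subst openin_Int_closure_of_eq_empty) auto
    ultimately have "X frontier_of C = {}" by (auto simp: frontier_of_def)
    then have "closedin X C" using openin_comps[OF C(1)] clopenin_eq_frontier_of openin_subset by blast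
    then show ?thesis
      using connected openin_comps[OF C(1)] comps_nonempty[OF C(1)] connected_space_clopen_in by auto
  next
    case False
    then obtain x where x: "x \<in> C" "x \<in> ?F"
      using connectedin_avoids_frontier[OF connectedin_comps[OF C(1)], of "K (Suc n)"] C(2) by blast
    then obtain D where "D \<in> \<F>" "x \<in> D" using \<F>(3) by blast
    then have "C = D" using comps_disjoint[OF C(1), of D] \<F>(2) x by blast
    then show ?thesis using \<open>D \<in> \<F>\<close> by blast
  qed
  then have "{C \<in> comps n. \<not> C \<subseteq> K (Suc n)} \<subseteq> insert (topspace X) \<F>" by blast
  then show ?thesis using \<F>(1) finite_subset by blast
qed

text \<open>The standard representatives of ends: branches of the tree of components.\<close>

lemma end_sequence_comps:
  assumes C: "\<And>n. C n \<in> comps n" "\<And>n. C (Suc n) \<subseteq> C n"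
  shows "end_sequence X C"
  unfolding end_sequence_def
proof (intro conjI allI impI)
  show "(\<Inter>n. X closure_of C n) = {}"
  proof (rule ccontr)
    assume "(\<Inter>n. X closure_of C n) \<noteq> {}"
    then obtain x where x: "\<And>n. x \<in> X closure_of C n" by blast
    then have "x \<in> topspace X" using closure_of_subset_topspace by fastforce
    then obtain m where "x \<in> K m" using Union_K by blast
    then have "x \<in> X interior_of K (Suc m)" using K_subset_interior by blast
    moreover have "X interior_of K (Suc m) \<inter> X closure_of C (Suc m) = {}"
      using comps_disjoint_K[OF C(1), of "Suc m"] interior_of_subset[of X "K (Suc m)"]
      by (subst openin_Int_closure_of_eq_empty) auto
    ultimately show False using x by blast
  qed
  show "\<exists>m. L \<inter> C m = {}" if L: "compactin X L" for L
    using compactin_subset_K[OF L] comps_disjoint_K[OF C(1)] by blast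
qed (rule C comps_nonempty[OF C(1)] openin_comps[OF C(1)] connectedin_comps[OF C(1)]
      compactin_frontier_of_comps[OF C(1)])+

lemma ends_in_some_comp:
  assumes "e \<in> ends X" shows "\<exists>C\<in>comps n. e \<in> ends_in X C"
proof -
  obtain U where U: "U \<in> e" "end_sequence X U" using assms by (rule ends_representative)
  obtain m where "K n \<inter> U m = {}" using compactin_K[of n] U(2) by (auto simp: end_sequence_def)
  moreover have "connectedin X (U m)" "U m \<noteq> {}" using U(2) by (auto simp: end_sequence_def)
  ultimately obtain C where "C \<in> comps n" "U m \<subseteq> C" using connectedin_subset_comp by (metis inf_commute)
  then show ?thesis using ends_in_iff[OF assms U(1)] by blast
qed

text \<open>Koenig's lemma for the tree of components. Call a set small if it is covered by a compact set
  and finitely many members of \<open>\<V>\<close>. If \<open>D\<close> is not small then, by finiteness, some component of the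
  complement of \<open>K 0\<close> meets \<open>D\<close> in a set that is not small, inside it some component of the
  complement of \<open>K 1\<close> does, and so on. The resulting branch is an end in \<open>D\<close>, so a member of \<open>\<V>\<close>
  contains one of the components of the branch, which is absurd.

  The case of a cover of all ends gives compactness, the case \<open>\<V> = {}\<close> the existence of ends.\<close>

lemma ends_in_cover:
  assumes D: "openin X D" "compactin X (X frontier_of D)"
    and cov: "ends_in X D \<subseteq> (\<Union>V\<in>\<V>. ends_in X V)"
  shows "\<exists>L \<V>'. compactin X L \<and> finite \<V>' \<and> \<V>' \<subseteq> \<V> \<and> D \<subseteq> L \<union> \<Union>\<V>'"
proof -
  define small where
    "small = (\<lambda>A. \<exists>L \<V>'. compactin X L \<and> finite \<V>' \<and> \<V>' \<subseteq> \<V> \<and> A \<subseteq> L \<union> \<Union>\<V>')"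
  have small_mono: "small A" if "small B" "A \<subseteq> B" for A B
    using that unfolding small_def by (meson subset_trans)
  have small_compact: "small A" if "compactin X L" "A \<subseteq> L" for A L
    unfolding small_def using that by (intro exI[of _ L] exI[of _ "{}"]) auto
  have small_member: "small V" if "V \<in> \<V>" for V
    unfolding small_def using that by (intro exI[of _ "{}"] exI[of _ "{V}"]) auto
  have small_Un: "small (A \<union> B)" if "small A" "small B" for A B
  proof -
    obtain L1 \<V>1 where "compactin X L1" "finite \<V>1" "\<V>1 \<subseteq> \<V>" "A \<subseteq> L1 \<union> \<Union>\<V>1"
      using \<open>small A\<close> unfolding small_def by (elim exE conjE)
    moreover obtain L2 \<V>2 where "compactin X L2" "finite \<V>2" "\<V>2 \<subseteq> \<V>" "B \<subseteq> L2 \<union> \<Union>\<V>2"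
      using \<open>small B\<close> unfolding small_def by (elim exE conjE)
    ultimately show ?thesis unfolding small_def
      by (intro exI[of _ "L1 \<union> L2"] exI[of _ "\<V>1 \<union> \<V>2"]) (auto simp: compactin_Un)
  qed
  have small_UN: "small (\<Union>\<A>)" if "finite \<A>" "\<forall>A\<in>\<A>. small A" for \<A>
    using that by (induction \<A>) (use small_Un small_compact[of "{}"] in auto)
  have descend: "\<exists>C\<in>comps n. \<not> small (C \<inter> A)" if A: "\<not> small A" "A \<subseteq> topspace X" for A n
  proof (rule ccontr)
    assume *: "\<not> ?thesis"
    let ?\<A> = "(\<lambda>C. C \<inter> A) ` {C \<in> comps n. \<not> C \<subseteq> K (Suc n)}"
    have "small (\<Union>?\<A>)" using * finite_unbounded_comps by (intro small_UN) auto
    moreover have "A \<subseteq> K (Suc n) \<union> \<Union>?\<A>"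
    proof
      fix x assume x: "x \<in> A"
      show "x \<in> K (Suc n) \<union> \<Union>?\<A>"
      proof (cases "x \<in> K (Suc n)")
        case False
        then have "x \<in> \<Union>(comps n)" using x A(2) K_mono[of n "Suc n"] unfolding Union_comps by auto
        then show ?thesis using False x by auto
      qed simp
    qed
    ultimately show False
      using A(1) small_mono small_Un small_compact[OF compactin_K order_refl] by metis
  qed
  have "small D"
  proof (rule ccontr)
    assume nD: "\<not> small D"
    have Dsub: "D \<subseteq> topspace X" using D(1) openin_subset by blast
    have "\<exists>C. \<forall>n. (C n \<in> comps n \<and> \<not> small (C n \<inter> D)) \<and> C (Suc n) \<subseteq> C n"
    proof (rule dependent_nat_choice)
      show "\<exists>C. C \<in> comps 0 \<and> \<not> small (C \<inter> D)" using descend[OF nD Dsub] by blast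
    next
      fix C n assume C: "C \<in> comps n \<and> \<not> small (C \<inter> D)"
      then obtain C' where C': "C' \<in> comps (Suc n)" "\<not> small (C' \<inter> (C \<inter> D))"
        using descend[of "C \<inter> D" "Suc n"] Dsub by blast
      have "C' \<inter> C \<noteq> {}"
      proof
        assume "C' \<inter> C = {}"
        then have "C' \<inter> (C \<inter> D) = {}" by blast
        then show False using C'(2) small_compact[of "{}"] by simp
      qed
      moreover have "C' \<inter> K n = {}" using comps_disjoint_K[OF C'(1)] K_mono[of n "Suc n"] by auto
      ultimately have "C' \<subseteq> C" using comps_maximal C connectedin_comps[OF C'(1)] by blast
      moreover from this have "C' \<inter> (C \<inter> D) = C' \<inter> D" by blast
      ultimately show "\<exists>C'. (C' \<in> comps (Suc n) \<and> \<not> small (C' \<inter> D)) \<and> C' \<subseteq> C" using C' by auto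
    qed
    then obtain C where C: "\<And>n. C n \<in> comps n" "\<And>n. \<not> small (C n \<inter> D)" "\<And>n. C (Suc n) \<subseteq> C n" by blast
    have "end_sequence X C" using end_sequence_comps C by blast
    then obtain e where e: "e \<in> ends X" "C \<in> e" using end_class by blast
    obtain n where "X frontier_of D \<subseteq> K n" using compactin_subset_K D(2) by blast
    then have "C n \<inter> X frontier_of D = {}" using comps_disjoint_K[OF C(1)] by blast
    moreover have "C n \<inter> D \<noteq> {}" using C(2)[of n] small_compact[of "{}"] by auto
    ultimately have "C n \<subseteq> D" using connectedin_avoids_frontier[OF connectedin_comps[OF C(1)]] by blast
    then have "e \<in> ends_in X D" using ends_in_iff[OF e] by blast
    then obtain V where V: "V \<in> \<V>" "e \<in> ends_in X V" using cov by blast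
    then obtain j where "C j \<subseteq> V" using ends_in_iff[OF e] by blast
    then show False using C(2)[of j] small_member[OF V(1)] small_mono by (meson inf.coboundedI1)
  qed
  then show ?thesis unfolding small_def .
qed

lemma ends_in_eq_empty_imp_bounded:
  assumes "openin X D" "compactin X (X frontier_of D)" "ends_in X D = {}"
  shows "\<exists>L. compactin X L \<and> D \<subseteq> L"
  using ends_in_cover[OF assms(1,2), of "{}"] assms(3) by auto

text \<open>The converse of \<open>ends_in_cover\<close>: far enough out, the component that contains a given end misses
  \<open>L\<close> and all the frontiers, and hence lies in a single member of \<open>\<V>\<close>. With \<open>\<V> = {}\<close> it says that there
  are no ends in a relatively compact set.\<close>

lemma ends_in_subset_finite_Union:
  assumes L: "compactin X L" and fin: "finite \<V>" and fr: "\<And>V. V \<in> \<V> \<Longrightarrow> compactin X (X frontier_of V)"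
    and D: "D \<subseteq> L \<union> \<Union>\<V>"
  shows "ends_in X D \<subseteq> (\<Union>V\<in>\<V>. ends_in X V)"
proof
  fix e assume e: "e \<in> ends_in X D"
  then have E: "e \<in> ends X" by (auto simp: ends_in_def)
  have "compactin X (L \<union> (\<Union>V\<in>\<V>. X frontier_of V))"
    using L fin fr by (intro compactin_Un compactin_Union) auto
  then obtain n where n: "L \<union> (\<Union>V\<in>\<V>. X frontier_of V) \<subseteq> K n" using compactin_subset_K by blast
  obtain C where C: "C \<in> comps n" "e \<in> ends_in X C" using ends_in_some_comp[OF E] by blast
  have "e \<in> ends_in X (C \<inter> D)" using C e by (simp add: ends_in_Int)
  then have "C \<inter> D \<noteq> {}" by auto
  moreover have "C \<inter> L = {}" "\<And>V. V \<in> \<V> \<Longrightarrow> C \<inter> X frontier_of V = {}"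
    using comps_disjoint_K[OF C(1)] n by blast+
  ultimately obtain V where V: "V \<in> \<V>" "C \<inter> V \<noteq> {}" using D by blast
  then have "C \<subseteq> V"
    using connectedin_avoids_frontier[OF connectedin_comps[OF C(1)]] \<open>\<And>V. V \<in> \<V> \<Longrightarrow> C \<inter> X frontier_of V = {}\<close>
    by blast
  then show "e \<in> (\<Union>V\<in>\<V>. ends_in X V)" using V(1) C(2) ends_in_mono by blast
qed

lemma compact_ends_space: "compact_space (ends_space X)"
  unfolding compact_space_def compactin_def topspace_ends_space
proof (intro conjI allI impI)
  fix \<U> assume \<U>: "Ball \<U> (openin (ends_space X)) \<and> ends X \<subseteq> \<Union>\<U>"
  define \<V> where "\<V> = {W. openin X W \<and> compactin X (X frontier_of W) \<and> (\<exists>F\<in>\<U>. ends_in X W \<subseteq> F)}"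
  have "ends_in X (topspace X) \<subseteq> (\<Union>V\<in>\<V>. ends_in X V)"
  proof
    fix e assume "e \<in> ends_in X (topspace X)"
    then obtain F where F: "F \<in> \<U>" "e \<in> F" using \<U> by (auto simp: ends_in_topspace)
    then show "e \<in> (\<Union>V\<in>\<V>. ends_in X V)"
      using openin_ends_space_base[of X F e] \<U> unfolding \<V>_def by blast
  qed
  then obtain L \<V>' where *: "compactin X L" "finite \<V>'" "\<V>' \<subseteq> \<V>" "topspace X \<subseteq> L \<union> \<Union>\<V>'"
    using ends_in_cover[of "topspace X" \<V>] by auto
  then have cov: "ends X \<subseteq> (\<Union>V\<in>\<V>'. ends_in X V)"
    using ends_in_subset_finite_Union[of L \<V>' "topspace X"] unfolding \<V>_def ends_in_topspace by blast
  have "\<forall>V\<in>\<V>. \<exists>F. F \<in> \<U> \<and> ends_in X V \<subseteq> F" unfolding \<V>_def by blast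
  then obtain f where f: "\<And>V. V \<in> \<V> \<Longrightarrow> f V \<in> \<U> \<and> ends_in X V \<subseteq> f V" by metis
  show "\<exists>\<F>. finite \<F> \<and> \<F> \<subseteq> \<U> \<and> ends X \<subseteq> \<Union>\<F>"
  proof (intro exI conjI)
    show "finite (f ` \<V>')" using *(2) by blast
    show "f ` \<V>' \<subseteq> \<U>" using *(3) f by blast
    show "ends X \<subseteq> \<Union>(f ` \<V>')"
    proof
      fix e assume "e \<in> ends X"
      then obtain V where "V \<in> \<V>'" "e \<in> ends_in X V" using cov by blast
      then show "e \<in> \<Union>(f ` \<V>')" using f *(3) by blast
    qed
  qed
qed simp

text \<open>Once \<open>K n\<close> contains the frontier of \<open>W\<close>, each component of its complement is on one side of
  \<open>W\<close>.\<close>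

lemma comps_ends_base:
  assumes "openin (ends_space X) F" "e \<in> F"
  shows "\<exists>n. \<exists>C\<in>comps n. e \<in> ends_in X C \<and> ends_in X C \<subseteq> F"
proof -
  obtain W where W: "compactin X (X frontier_of W)" "e \<in> ends_in X W" "ends_in X W \<subseteq> F"
    using openin_ends_space_base[OF assms] by blast
  obtain n where n: "X frontier_of W \<subseteq> K n" using compactin_subset_K W(1) by blast
  have "e \<in> ends X" using W(2) by (auto simp: ends_in_def)
  then obtain C where C: "C \<in> comps n" "e \<in> ends_in X C" using ends_in_some_comp by blast
  have "C \<inter> W \<noteq> {}" using C(2) W(2) ends_in_disjoint by blast
  then have "C \<subseteq> W"
    using connectedin_avoids_frontier[OF connectedin_comps[OF C(1)]] comps_disjoint_K[OF C(1)] n by blast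
  then show ?thesis using C W(3) ends_in_mono by blast
qed

lemma countable_clopen_base_ends:
  "\<exists>\<C>. countable \<C> \<and> (\<forall>A\<in>\<C>. openin (ends_space X) A \<and> closedin (ends_space X) A) \<and>
       (\<forall>F e. openin (ends_space X) F \<and> e \<in> F \<longrightarrow> (\<exists>A\<in>\<C>. e \<in> A \<and> A \<subseteq> F))"
proof (intro exI conjI ballI allI impI)
  let ?\<C> = "\<Union>n. ends_in X ` comps n"
  have "ends_in X C = {}" if "C \<in> comps n" "C \<subseteq> K (Suc n)" for C n
    using ends_in_subset_finite_Union[OF compactin_K, of "{}" C "Suc n"] that by auto
  then have "ends_in X ` comps n \<subseteq> insert {} (ends_in X ` {C \<in> comps n. \<not> C \<subseteq> K (Suc n)})" for n by blast
  then have "finite (ends_in X ` comps n)" for n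
    using finite_unbounded_comps by (meson finite_imageI finite_insert finite_subset)
  then show "countable ?\<C>" by (simp add: uncountable_infinite countable_finite)
  fix A assume "A \<in> ?\<C>"
  then show "openin (ends_space X) A" "closedin (ends_space X) A"
    using openin_ends_in[OF openin_comps compactin_frontier_of_comps]
      closedin_ends_in[OF openin_comps compactin_frontier_of_comps] by auto
next
  fix F e assume "openin (ends_space X) F \<and> e \<in> F"
  then obtain n C where "C \<in> comps n" "e \<in> ends_in X C" "ends_in X C \<subseteq> F" using comps_ends_base by blast
  then show "\<exists>A\<in>\<Union>n. ends_in X ` comps n. e \<in> A \<and> A \<subseteq> F" by blast
qed

lemma eventually_in_distinct_comps:
  assumes "e \<in> ends X" "e' \<in> ends X" "e \<noteq> e'"
  shows "\<exists>m. \<forall>n\<ge>m. \<forall>C\<in>comps n. \<not> (e \<in> ends_in X C \<and> e' \<in> ends_in X C)"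
proof -
  obtain F where F: "openin (ends_space X) F" "e \<in> F" "e' \<notin> F"
    using Hausdorff_ends_space[of X] assms unfolding Hausdorff_space_def disjnt_def topspace_ends_space by blast
  obtain W where W: "compactin X (X frontier_of W)" "e \<in> ends_in X W" "ends_in X W \<subseteq> F"
    using openin_ends_space_base[OF F(1,2)] by blast
  obtain m where m: "X frontier_of W \<subseteq> K m" using compactin_subset_K W(1) by blast
  have "\<not> (e \<in> ends_in X C \<and> e' \<in> ends_in X C)" if "n \<ge> m" and C: "C \<in> comps n" for n C
  proof
    assume *: "e \<in> ends_in X C \<and> e' \<in> ends_in X C"
    then have "C \<inter> W \<noteq> {}" using W(2) ends_in_disjoint by blast
    then have "C \<subseteq> W"
      using connectedin_avoids_frontier[OF connectedin_comps[OF C]] comps_disjoint_K[OF C] m K_mono[OF \<open>n \<ge> m\<close>]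
      by blast
    then show False using * ends_in_mono W(3) F(3) by blast
  qed
  then show ?thesis by blast
qed

text \<open>The argument of Freudenthal and Hopf. Let \<open>C\<close> be a component of the complement of \<open>K m\<close> that
  contains a single end, and let \<open>D1\<close>, \<open>D2\<close>, \<open>D3\<close> be components of the complement of \<open>K n\<close> that
  contain three different ends. Move \<open>K n\<close> into \<open>C\<close> by a homeomorphism \<open>g\<close>. The connected set \<open>K m\<close>
  misses \<open>g ` K n\<close>, so it meets the image of at most one of the \<open>Di\<close>. The images of the other two
  touch \<open>g ` K n\<close> but not \<open>K m\<close>, so they are contained in \<open>C\<close>. As they are disjoint and unbounded,
  they provide two ends in \<open>C\<close>.\<close>

lemma three_ends_imp_perfect:
  assumes conK: "\<And>n. connectedin X (K n)"
    and hom: "\<And>n m C. C \<in> comps m \<Longrightarrow> \<nexists>L. compactin X L \<and> C \<subseteq> L \<Longrightarrow>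
        \<exists>g. homeomorphic_map X X g \<and> g ` K n \<inter> K m = {} \<and> g ` K n \<inter> C \<noteq> {}"
    and three: "e1 \<in> ends X" "e2 \<in> ends X" "e3 \<in> ends X" "e1 \<noteq> e2" "e1 \<noteq> e3" "e2 \<noteq> e3"
  shows "\<not> openin (ends_space X) {e}"
proof
  assume iso: "openin (ends_space X) {e}"
  obtain m C where C: "C \<in> comps m" "ends_in X C = {e}"
    using comps_ends_base[OF iso] by blast
  obtain n12 where n12: "\<And>n C. n \<ge> n12 \<Longrightarrow> C \<in> comps n \<Longrightarrow> \<not> (e1 \<in> ends_in X C \<and> e2 \<in> ends_in X C)"
    using eventually_in_distinct_comps[of e1 e2] three by blast
  obtain n13 where n13: "\<And>n C. n \<ge> n13 \<Longrightarrow> C \<in> comps n \<Longrightarrow> \<not> (e1 \<in> ends_in X C \<and> e3 \<in> ends_in X C)"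
    using eventually_in_distinct_comps[of e1 e3] three by blast
  obtain n23 where n23: "\<And>n C. n \<ge> n23 \<Longrightarrow> C \<in> comps n \<Longrightarrow> \<not> (e2 \<in> ends_in X C \<and> e3 \<in> ends_in X C)"
    using eventually_in_distinct_comps[of e2 e3] three by blast
  define n where "n = Max {n12, n13, n23}"
  have n: "n \<ge> n12" "n \<ge> n13" "n \<ge> n23" unfolding n_def by auto
  obtain D1 D2 D3 where D: "D1 \<in> comps n" "D2 \<in> comps n" "D3 \<in> comps n"
    and eD: "e1 \<in> ends_in X D1" "e2 \<in> ends_in X D2" "e3 \<in> ends_in X D3"
    using three(1-3)[THEN ends_in_some_comp, of n] by blast
  have neq: "D1 \<noteq> D2" "D1 \<noteq> D3" "D2 \<noteq> D3" using n12 n13 n23 n D eD by blast+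
  have unb: "\<nexists>L. compactin X L \<and> E \<subseteq> L" if "ends_in X E \<noteq> {}" for E
  proof
    assume "\<exists>L. compactin X L \<and> E \<subseteq> L"
    then obtain L where "compactin X L" "E \<subseteq> L" by blast
    then show False using ends_in_subset_finite_Union[of L "{}" E] that by auto
  qed
  obtain g where g: "homeomorphic_map X X g" "g ` K n \<inter> K m = {}" "g ` K n \<inter> C \<noteq> {}"
    using hom[OF C(1) unb[of C], of n] C(2) by auto
  obtain h where gh: "homeomorphic_maps X X g h" using g(1) homeomorphic_map_maps by blast
  then have hg: "\<And>x. x \<in> topspace X \<Longrightarrow> h (g x) = x" "\<And>x. x \<in> topspace X \<Longrightarrow> g (h x) = x"
    and cont: "continuous_map X X g" "continuous_map X X h"
    by (auto simp: homeomorphic_maps_def)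
  have e_in: "e \<in> ends_in X (g ` D)" if D: "D \<in> comps n" "e' \<in> ends_in X D" "g ` D \<inter> K m = {}" for D e'
  proof -
    have Dsub: "D \<subseteq> topspace X" using openin_comps[OF D(1)] openin_subset by blast
    have "X frontier_of D \<noteq> {}"
    proof
      assume "X frontier_of D = {}"
      then have "D = topspace X"
        using connected openin_comps[OF D(1)] comps_nonempty[OF D(1)] Dsub
          clopenin_eq_frontier_of[of X D] connected_space_clopen_in by auto
      then show False using comps_disjoint_K[OF D(1)] K_subset_topspace g(3) by blast
    qed
    then obtain x where x: "x \<in> X closure_of D" "x \<in> K n"
      using frontier_of_comps[OF D(1)] by (auto simp: frontier_of_def)
    have "connectedin X (insert x D)"
      using connectedin_intermediate_closure_of[OF connectedin_comps[OF D(1)], of "insert x D"]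
        x(1) closure_of_subset[OF Dsub] by blast
    then have "connectedin X (K n \<union> insert x D)" using connectedin_Un conK x(2) by blast
    moreover have "K n \<union> insert x D = K n \<union> D" using x(2) by blast
    ultimately have "connectedin X (K n \<union> D)" by simp
    then have "connectedin X (g ` (K n \<union> D))" using connectedin_continuous_map_image cont(1) by blast
    moreover have "g ` (K n \<union> D) \<inter> K m = {}" using g(2) D(3) by blast
    moreover have "g ` (K n \<union> D) \<inter> C \<noteq> {}" using g(3) by blast
    ultimately have "g ` D \<subseteq> C" using comps_maximal[OF C(1)] by blast
    then have "ends_in X (g ` D) \<subseteq> {e}" using C(2) ends_in_mono[of "g ` D" C X] by simp
    moreover have "ends_in X (g ` D) \<noteq> {}"
    proof
      assume empty: "ends_in X (g ` D) = {}"
      have "openin X (g ` D)"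
        using g(1) openin_comps[OF D(1)] homeomorphic_imp_open_map open_map_def by blast
      moreover have "compactin X (X frontier_of (g ` D))"
        unfolding homeomorphic_map_frontier_of[OF g(1) Dsub]
        by (rule image_compactin[OF compactin_frontier_of_comps[OF D(1)] cont(1)])
      ultimately obtain L where L: "compactin X L" "g ` D \<subseteq> L"
        using ends_in_eq_empty_imp_bounded empty by blast
      have "D \<subseteq> h ` L" using L(2) hg(1) Dsub by force
      then show False using unb[of D] D(2) image_compactin[OF L(1) cont(2)] by blast
    qed
    ultimately show ?thesis by blast
  qed
  have not_both: False
    if D: "D \<in> comps n" "e' \<in> ends_in X D" "g ` D \<inter> K m = {}"
      "D' \<in> comps n" "e'' \<in> ends_in X D'" "g ` D' \<inter> K m = {}" "D \<noteq> D'" for D D' e' e''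
  proof -
    have "D \<subseteq> topspace X" "D' \<subseteq> topspace X" using openin_comps D openin_subset by blast+
    then have "g ` D \<inter> g ` D' = g ` (D \<inter> D')"
      using inj_on_image_Int[of g "topspace X" D D'] inj_on_inverseI[of "topspace X" h g] hg(1) by simp
    then have "g ` D \<inter> g ` D' = {}" using comps_disjoint[OF D(1,4,7)] by simp
    then show False using e_in[OF D(1-3)] e_in[OF D(4-6)] ends_in_disjoint[of "g ` D" "g ` D'" X] by blast
  qed
  \<comment> \<open>\<open>h ` K m\<close> is connected and misses \<open>K n\<close>, so it lies in a single component.\<close>
  have hK: "h ` K m \<inter> K n = {}"
  proof (rule ccontr)
    assume "h ` K m \<inter> K n \<noteq> {}"
    then obtain y where "y \<in> K m" "h y \<in> K n" by blast
    moreover from this have "g (h y) = y" using hg(2) K_subset_topspace by blast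
    ultimately show False using g(2) by (metis IntI empty_iff imageI)
  qed
  have meet: "h ` K m \<subseteq> D" if Dm: "D \<in> comps n" "g ` D \<inter> K m \<noteq> {}" for D
  proof -
    obtain x where x: "x \<in> D" "g x \<in> K m" using Dm(2) by blast
    then have "h (g x) = x" using hg(1) openin_subset[OF openin_comps[OF Dm(1)]] by blast
    then have "h ` K m \<inter> D \<noteq> {}" using x by (metis IntI empty_iff imageI)
    then show "h ` K m \<subseteq> D"
      using comps_maximal[OF Dm(1) connectedin_continuous_map_image[OF cont(2) conK] hK] by blast
  qed
  have miss: "g ` D' \<inter> K m = {}" if D: "D \<in> comps n" "D' \<in> comps n" "D \<noteq> D'" "g ` D \<inter> K m \<noteq> {}" for D D'
  proof (rule ccontr)
    assume "g ` D' \<inter> K m \<noteq> {}"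
    then have "h ` K m \<subseteq> D \<inter> D'" using meet[OF D(1,4)] meet[OF D(2)] by blast
    then show False using comps_disjoint[OF D(1-3)] D(4) by blast
  qed
  show False
  proof (cases "g ` D1 \<inter> K m = {}")
    case True
    then have "g ` D2 \<inter> K m \<noteq> {}" "g ` D3 \<inter> K m \<noteq> {}"
      using not_both[OF D(1) eD(1) _ D(2) eD(2) _ neq(1)] not_both[OF D(1) eD(1) _ D(3) eD(3) _ neq(2)] by blast+
    then show False using miss[OF D(2,3) neq(3)] by blast
  next
    case False
    then have "g ` D2 \<inter> K m = {}" "g ` D3 \<inter> K m = {}"
      using miss[OF D(1,2) neq(1)] miss[OF D(1,3) neq(2)] by blast+
    then show False using not_both[OF D(2) eD(2) _ D(3) eD(3) _ neq(3)] by blast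
  qed
qed

end

section \<open>A characterization of the Cantor set\<close>

text \<open>Points of the Cantor set are coded by their ternary expansions with digits 0 (for \<open>True\<close>, the
  left third) and 2 (for \<open>False\<close>, the right third).\<close>

definition cantor_sum :: "(nat \<Rightarrow> bool) \<Rightarrow> real" where
  "cantor_sum b = suminf (\<lambda>n. (if b n then 0 else 2) / 3 ^ Suc n)"

lemma summable_cantor: "summable (\<lambda>n. (if b n then 0 else 2) / 3 ^ Suc n :: real)"
proof (rule summable_comparison_test')
  show "summable (\<lambda>n. (2/3) * (1/3 :: real) ^ n)" by (intro summable_mult summable_geometric) simp
  show "norm ((if b n then 0 else 2) / 3 ^ Suc n :: real) \<le> (2/3) * (1/3) ^ n" for n
    by (simp add: power_divide)
qed

lemma cantor_sum_step:
  "cantor_sum b = (if b 0 then 0 else 2 / 3) + cantor_sum (\<lambda>n. b (Suc n)) / 3"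
proof -
  have "cantor_sum b = (if b 0 then 0 else 2) / 3 ^ Suc 0 + suminf (\<lambda>n. (if b (Suc n) then 0 else 2) / 3 ^ Suc (Suc n))"
    unfolding cantor_sum_def using suminf_split_head[OF summable_cantor[of b]] by simp
  also have "suminf (\<lambda>n. (if b (Suc n) then 0 else 2) / 3 ^ Suc (Suc n)) = cantor_sum (\<lambda>n. b (Suc n)) / 3"
    unfolding cantor_sum_def suminf_divide[OF summable_cantor, symmetric] by (simp add: mult.commute)
  finally show ?thesis by simp
qed

lemma cantor_sum_bounds: "0 \<le> cantor_sum b" "cantor_sum b \<le> 1"
proof -
  show "0 \<le> cantor_sum b" unfolding cantor_sum_def by (intro suminf_nonneg summable_cantor) simp
  have "(\<lambda>n. (2/3) * (1/3 :: real) ^ n) sums ((2/3) * (1 / (1 - 1/3)))"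
    by (intro sums_mult geometric_sums) simp
  then have s: "(\<lambda>n. (2/3) * (1/3 :: real) ^ n) sums 1" by simp
  have "cantor_sum b \<le> suminf (\<lambda>n. (2/3) * (1/3 :: real) ^ n)"
    unfolding cantor_sum_def
    by (intro suminf_le summable_cantor sums_summable[OF s]) (simp add: power_divide)
  then show "cantor_sum b \<le> 1" using sums_unique[OF s] by simp
qed

lemma cantor_sum_inj: "cantor_sum b = cantor_sum b' \<Longrightarrow> b n = b' n"
proof (induction n arbitrary: b b')
  have first: "b 0 \<longleftrightarrow> cantor_sum b \<le> 1 / 3" for b
    using cantor_sum_step[of b] cantor_sum_bounds[of "\<lambda>n. b (Suc n)"] by auto
  { case 0 then show ?case using first by metis }
  case (Suc n)
  have "b 0 = b' 0" using first Suc.prems by metis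
  then have "cantor_sum (\<lambda>n. b (Suc n)) = cantor_sum (\<lambda>n. b' (Suc n))"
    using cantor_sum_step[of b] cantor_sum_step[of b'] Suc.prems by simp
  then show ?case using Suc.IH[of "\<lambda>n. b (Suc n)" "\<lambda>n. b' (Suc n)"] by simp
qed

lemma abs_third_le:
  fixes c d :: real
  assumes "c = d / 3" "\<bar>d\<bar> \<le> (1 / 3) ^ n" shows "\<bar>c\<bar> \<le> (1 / 3) ^ Suc n"
  using assms(2) unfolding assms(1) by (simp only: abs_divide power_Suc)

lemma cantor_sum_close:
  "(\<And>k. k < n \<Longrightarrow> b k = b' k) \<Longrightarrow> \<bar>cantor_sum b - cantor_sum b'\<bar> \<le> (1 / 3) ^ n"
proof (induction n arbitrary: b b')
  case 0
  then show ?case using cantor_sum_bounds[of b] cantor_sum_bounds[of b'] by simp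
next
  case (Suc n)
  have "cantor_sum b - cantor_sum b' = (cantor_sum (\<lambda>n. b (Suc n)) - cantor_sum (\<lambda>n. b' (Suc n))) / 3"
    using cantor_sum_step[of b] cantor_sum_step[of b'] Suc.prems[of 0] by simp
  moreover have "\<bar>cantor_sum (\<lambda>n. b (Suc n)) - cantor_sum (\<lambda>n. b' (Suc n))\<bar> \<le> (1 / 3) ^ n"
    by (rule Suc.IH) (simp add: Suc.prems)
  ultimately show ?case using abs_third_le by blast
qed

lemma cantor_sum_in_step: "cantor_sum b \<in> cantor_step n"
proof (induction n arbitrary: b)
  case 0
  then show ?case using cantor_sum_bounds by simp
next
  case (Suc n)
  then show ?case
    using cantor_sum_step[of b] by (cases "b 0") (auto intro!: image_eqI[of _ _ "cantor_sum (\<lambda>n. b (Suc n))"])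
qed

lemma cantor_step_bounds: "x \<in> cantor_step n \<Longrightarrow> 0 \<le> x \<and> x \<le> 1"
  by (induction n arbitrary: x) fastforce+

text \<open>The digits of a point of the Cantor set are its itinerary under the map \<open>\<sigma>\<close> that expands the
  left and the right third to the whole interval.\<close>

lemma range_cantor_sum: "range cantor_sum = cantor_set"
proof
  show "range cantor_sum \<subseteq> cantor_set" using cantor_sum_in_step by (auto simp: cantor_set_def)
  define \<sigma> :: "real \<Rightarrow> real" where "\<sigma> x = (if x \<le> 1 / 3 then 3 * x else 3 * x - 2)" for x
  have \<sigma>: "\<sigma> x \<in> cantor_set" if x: "x \<in> cantor_set" for x
  proof -
    have "\<sigma> x \<in> cantor_step n" for n
    proof -
      have "x \<in> cantor_step (Suc n)" using x by (simp add: cantor_set_def del: cantor_step.simps)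
      then obtain y where y: "y \<in> cantor_step n" "x = y / 3 \<or> x = 2 / 3 + y / 3" by auto
      have "\<sigma> x = y"
      proof (cases "x \<le> 1 / 3")
        case True
        then have "x = y / 3" using y(2) cantor_step_bounds[OF y(1)] by linarith
        then show ?thesis using True by (simp add: \<sigma>_def)
      next
        case False
        then have "x = 2 / 3 + y / 3" using y(2) cantor_step_bounds[OF y(1)] by linarith
        then show ?thesis using False by (simp add: \<sigma>_def)
      qed
      then show ?thesis using y(1) by simp
    qed
    then show ?thesis by (simp add: cantor_set_def)
  qed
  show "cantor_set \<subseteq> range cantor_sum"
  proof
    fix x assume x: "x \<in> cantor_set"
    define b where "b x n = ((\<sigma> ^^ n) x \<le> 1 / 3)" for x n
    have close: "\<bar>x - cantor_sum (b x)\<bar> \<le> (1 / 3) ^ n" if "x \<in> cantor_set" for n x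
      using that
    proof (induction n arbitrary: x)
      case 0
      then have "0 \<le> x \<and> x \<le> 1" using cantor_step_bounds[of x 0] INT_D[of x cantor_step UNIV 0]
        by (simp add: cantor_set_def)
      then show ?case using cantor_sum_bounds[of "b x"] by (simp add: abs_le_iff)
    next
      case (Suc n)
      have "(\<lambda>n. b x (Suc n)) = b (\<sigma> x)" by (simp add: fun_eq_iff b_def funpow_swap1)
      then have "x - cantor_sum (b x) = (\<sigma> x - cantor_sum (b (\<sigma> x))) / 3"
        using cantor_sum_step[of "b x"] by (simp add: b_def \<sigma>_def)
      then show ?case using abs_third_le Suc.IH[OF \<sigma>[OF Suc.prems]] by blast
    qed
    have "(\<lambda>n. (1 / 3 :: real) ^ n) \<longlonglongrightarrow> 0" by (rule LIMSEQ_power_zero) simp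
    then have "\<bar>x - cantor_sum (b x)\<bar> \<le> 0" using close[OF x] by (intro LIMSEQ_le_const) auto
    then show "x \<in> range cantor_sum" by auto
  qed
qed

text \<open>Brouwer's characterization of the Cantor set. Split the space into two nonempty clopen pieces,
  split each of these, and so on. There is always a way to split a piece as no point is
  isolated. At stage \<open>n\<close> the \<open>n\<close>-th set of the base is used for the splitting whenever this is
  possible, so that any two points are eventually separated. Sending a point to the sequence of
  the choices made is then a bijection onto all sequences of bits (surjective by compactness).\<close>

theorem homeomorphic_cantor_set:
  assumes comp: "compact_space Y" and haus: "Hausdorff_space Y" and ne: "topspace Y \<noteq> {}"
    and count: "countable \<C>" and clopen: "\<And>A. A \<in> \<C> \<Longrightarrow> openin Y A \<and> closedin Y A"
    and base: "\<And>F y. openin Y F \<Longrightarrow> y \<in> F \<Longrightarrow> \<exists>A\<in>\<C>. y \<in> A \<and> A \<subseteq> F"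
    and perfect: "\<And>y. \<not> openin Y {y}"
  shows "Y homeomorphic_space top_of_set cantor_set"
proof -
  have "\<C> \<noteq> {}" using base[OF openin_topspace] ne by blast
  define W where "W = from_nat_into \<C>"
  have W: "W n \<in> \<C>" for n unfolding W_def by (rule from_nat_into[OF \<open>\<C> \<noteq> {}\<close>])
  have Wsurj: "\<exists>n. W n = A" if "A \<in> \<C>" for A
    unfolding W_def using from_nat_into_surj[OF count that] .
  define cl where "cl A \<longleftrightarrow> openin Y A \<and> closedin Y A \<and> A \<noteq> {}" for A
  define splits where "splits n A S \<longleftrightarrow> cl S \<and> cl (A - S) \<and> S \<subseteq> A \<and>
      (W n \<inter> A \<noteq> {} \<and> A - W n \<noteq> {} \<longrightarrow> S = W n \<inter> A)" for n A S
  have split_exists: "\<exists>S. splits n A S" if A: "cl A" for A n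
  proof (cases "W n \<inter> A \<noteq> {} \<and> A - W n \<noteq> {}")
    case True
    have "A - W n \<inter> A = A - W n" by blast
    then show ?thesis using True A clopen[OF W[of n]]
      by (intro exI[of _ "W n \<inter> A"]) (auto simp: splits_def cl_def openin_diff closedin_diff)
  next
    case False
    obtain y where y: "y \<in> A" using A by (auto simp: cl_def)
    have "A \<noteq> {y}" using A perfect by (auto simp: cl_def)
    then obtain z where z: "z \<in> A" "z \<noteq> y" using y by blast
    have "y \<in> topspace Y" "z \<in> topspace Y" using y z A openin_subset by (auto simp: cl_def)
    then obtain U V where UV: "openin Y U" "openin Y V" "y \<in> U" "z \<in> V" "disjnt U V"
      using haus z(2) unfolding Hausdorff_space_def by metis
    then obtain B where B: "B \<in> \<C>" "y \<in> B" "B \<subseteq> U" using base by blast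
    have "A - B \<inter> A = A - B" by blast
    then have "cl (A - B \<inter> A)" "cl (B \<inter> A)"
      using A clopen[OF B(1)] y z B UV by (auto simp: cl_def openin_diff closedin_diff disjnt_iff)
    then show ?thesis using False by (intro exI[of _ "B \<inter> A"]) (auto simp: splits_def)
  qed
  define sp where "sp n A = (SOME S. splits n A S)" for n A
  have sp: "cl (sp n A)" "cl (A - sp n A)" "sp n A \<subseteq> A"
    "W n \<inter> A \<noteq> {} \<Longrightarrow> A - W n \<noteq> {} \<Longrightarrow> sp n A = W n \<inter> A" if "cl A" for n A
  proof -
    have "splits n A (sp n A)" unfolding sp_def by (rule someI_ex[OF split_exists[OF that]])
    then show "cl (sp n A)" "cl (A - sp n A)" "sp n A \<subseteq> A"
      "W n \<inter> A \<noteq> {} \<Longrightarrow> A - W n \<noteq> {} \<Longrightarrow> sp n A = W n \<inter> A"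
      unfolding splits_def by blast+
  qed
  define Q where "Q b = rec_nat (topspace Y) (\<lambda>n A. if b n then sp n A else A - sp n A)"
    for b :: "nat \<Rightarrow> bool"
  have Q0: "Q b 0 = topspace Y" and QSuc: "Q b (Suc n) = (if b n then sp n (Q b n) else Q b n - sp n (Q b n))"
    for b n by (simp_all add: Q_def)
  have clQ: "cl (Q b n)" for b n
    using ne sp by (induction n) (auto simp: Q0 QSuc, auto simp: cl_def)
  have Qdec: "Q b (Suc n) \<subseteq> Q b n" for b n using sp(3)[OF clQ] by (auto simp: QSuc)
  have Qcong: "Q b n = Q b' n" if "\<And>k. k < n \<Longrightarrow> b k = b' k" for b b' n
    using that by (induction n) (auto simp: Q0 QSuc)
  have digits_unique: "b = b'" if "\<And>n. y \<in> Q b n" "\<And>n. y \<in> Q b' n" for y b b'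
  proof -
    have "b n = b' n" for n
    proof (induction n rule: less_induct)
      case (less n)
      then have "Q b n = Q b' n" using Qcong by blast
      then show ?case using that(1)[of "Suc n"] that(2)[of "Suc n"] by (auto simp: QSuc split: if_splits)
    qed
    then show ?thesis by blast
  qed
  have digits_exist: "\<exists>b. \<forall>n. y \<in> Q b n" if y: "y \<in> topspace Y" for y
  proof -
    \<comment> \<open>The itinerary of \<open>y\<close>: at every stage the piece that contains \<open>y\<close>.\<close>
    define P where "P = rec_nat (topspace Y) (\<lambda>n A. if y \<in> sp n A then sp n A else A - sp n A)"
    define b where "b n = (y \<in> sp n (P n))" for n
    have "P n = Q b n \<and> y \<in> Q b n" for n
      using y by (induction n) (auto simp: P_def b_def Q_def)
    then show ?thesis by blast
  qed
  then obtain \<beta> where \<beta>: "\<And>y n. y \<in> topspace Y \<Longrightarrow> y \<in> Q (\<beta> y) n" by metis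
  have \<beta>_agree: "\<beta> z k = \<beta> y k" if y: "y \<in> topspace Y" and z: "z \<in> Q (\<beta> y) n" and k: "k < n" for y z n k
    using k
  proof (induction k rule: less_induct)
    case (less k)
    have "z \<in> topspace Y" using z clQ[of "\<beta> y" n] openin_subset unfolding cl_def by blast
    have "Q (\<beta> y) n \<subseteq> Q (\<beta> y) (Suc k)"
      using lift_Suc_antimono_le[of "Q (\<beta> y)" "Suc k" n] Qdec less.prems by simp
    then have "z \<in> Q (\<beta> y) (Suc k)" "z \<in> Q (\<beta> z) (Suc k)" using z \<beta>[OF \<open>z \<in> topspace Y\<close>] by auto
    moreover have "Q (\<beta> y) k = Q (\<beta> z) k" using less by (intro Qcong) auto
    ultimately show ?case by (auto simp: QSuc split: if_splits)
  qed
  have inj: "inj_on \<beta> (topspace Y)"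
  proof (rule inj_onI, rule ccontr)
    fix y z assume yz: "y \<in> topspace Y" "z \<in> topspace Y" "\<beta> y = \<beta> z" "y \<noteq> z"
    then obtain U V where UV: "openin Y U" "openin Y V" "y \<in> U" "z \<in> V" "disjnt U V"
      using haus unfolding Hausdorff_space_def by metis
    then obtain B where B: "B \<in> \<C>" "y \<in> B" "B \<subseteq> U" using base by blast
    obtain n where n: "W n = B" using Wsurj[OF B(1)] by blast
    have yzQ: "y \<in> Q (\<beta> y) k" "z \<in> Q (\<beta> y) k" for k using \<beta> yz by metis+
    have "y \<in> W n" "z \<notin> W n" using n B UV by (auto simp: disjnt_iff)
    then have "sp n (Q (\<beta> y) n) = W n \<inter> Q (\<beta> y) n"
      using yzQ[of n] by (intro sp(4)[OF clQ]) auto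
    then show False using yzQ[of "Suc n"] \<open>y \<in> W n\<close> \<open>z \<notin> W n\<close> by (auto simp: QSuc split: if_splits)
  qed
  have surj: "b \<in> \<beta> ` topspace Y" for b
  proof -
    have "(\<Inter>n. Q b n) \<noteq> {}"
    proof (rule compact_space_imp_nest[OF comp])
      show "decseq (Q b)" using Qdec by (simp add: decseq_Suc_iff)
    qed (use clQ in \<open>auto simp: cl_def\<close>)
    then obtain y where y: "\<And>n. y \<in> Q b n" by blast
    then have "y \<in> topspace Y" by (metis Q0)
    then have "\<beta> y = b" using digits_unique \<beta> y by metis
    then show ?thesis using \<open>y \<in> topspace Y\<close> by blast
  qed
  define f where "f y = cantor_sum (\<beta> y)" for y
  have "continuous_map Y euclideanreal f"
    unfolding Met_TC.continuous_map_to_metric[of Y f, simplified]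
  proof (intro ballI allI impI)
    fix y and \<epsilon> :: real assume y: "y \<in> topspace Y" and "\<epsilon> > 0"
    then obtain n where n: "(1 / 3) ^ n < \<epsilon>" using real_arch_pow_inv[of \<epsilon> "1 / 3"] by auto
    have "dist (f y) (f z) < \<epsilon>" if "z \<in> Q (\<beta> y) n" for z
      using cantor_sum_close[of n "\<beta> y" "\<beta> z"] \<beta>_agree[OF y that] n by (auto simp: f_def dist_real_def)
    then show "\<exists>U. openin Y U \<and> y \<in> U \<and> (\<forall>z\<in>U. dist (f y) (f z) < \<epsilon>)"
      using clQ \<beta>[OF y] by (intro exI[of _ "Q (\<beta> y) n"]) (auto simp: cl_def)
  qed
  have "\<beta> ` topspace Y = UNIV" using surj by blast
  then have "f ` topspace Y = cantor_set"
    unfolding f_def range_cantor_sum[symmetric] by (metis image_image)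
  moreover have "inj_on f (topspace Y)"
  proof (rule inj_onI)
    fix y z assume *: "y \<in> topspace Y" "z \<in> topspace Y" "f y = f z"
    then have "\<beta> y = \<beta> z" using cantor_sum_inj unfolding f_def by blast
    then show "y = z" using inj_onD[OF inj] * by blast
  qed
  moreover have "continuous_map Y (top_of_set cantor_set) f"
    using \<open>continuous_map Y euclideanreal f\<close> \<open>f ` topspace Y = cantor_set\<close>
    by (auto simp: continuous_map_in_subtopology)
  ultimately have "homeomorphic_map Y (top_of_set cantor_set) f"
    using comp by (intro continuous_imp_homeomorphic_map) (auto intro: Hausdorff_space_subtopology)
  then show ?thesis using homeomorphic_map_imp_homeomorphic_space by blast
qed

section \<open>The number of ends of a homogeneous space\<close>

context exhausted_space
begin

text \<open>Without three distinct ends there are one or two, as a noncompact space has an end. With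
  three, there are no isolated ends; in particular the ends space, being Hausdorff, is not finite.\<close>

lemma homogeneous_ends:
  assumes noncompact: "\<not> compact_space X"
    and conK: "\<And>n. connectedin X (K n)"
    and hom: "\<And>n m C. C \<in> comps m \<Longrightarrow> \<nexists>L. compactin X L \<and> C \<subseteq> L \<Longrightarrow>
        \<exists>g. homeomorphic_map X X g \<and> g ` K n \<inter> K m = {} \<and> g ` K n \<inter> C \<noteq> {}"
  shows "card (ends X) = 1 \<or> card (ends X) = 2 \<or>
    infinite (ends X) \<and> ends_space X homeomorphic_space top_of_set cantor_set"
proof (cases "\<exists>e1\<in>ends X. \<exists>e2\<in>ends X. \<exists>e3\<in>ends X. e1 \<noteq> e2 \<and> e1 \<noteq> e3 \<and> e2 \<noteq> e3")
  case True
  then obtain e1 e2 e3 where three: "e1 \<in> ends X" "e2 \<in> ends X" "e3 \<in> ends X"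
    "e1 \<noteq> e2" "e1 \<noteq> e3" "e2 \<noteq> e3" by (elim bexE conjE)
  have perfect: "\<not> openin (ends_space X) {e}" for e
    by (rule three_ends_imp_perfect[OF conK hom three])
  have "infinite (ends X)"
  proof
    assume fin: "finite (ends X)"
    have "closedin (ends_space X) (ends X - {e1})"
      using fin by (simp add: closedin_Hausdorff_finite[OF Hausdorff_ends_space])
    then have "openin (ends_space X) (ends X - (ends X - {e1}))"
      using openin_diff[OF openin_topspace] by (metis topspace_ends_space)
    moreover have "ends X - (ends X - {e1}) = {e1}" using three(1) by blast
    ultimately show False using perfect by simp
  qed
  moreover have "ends_space X homeomorphic_space top_of_set cantor_set"
  proof -
    obtain \<C> where \<C>: "countable \<C>" "\<And>A. A \<in> \<C> \<Longrightarrow> openin (ends_space X) A \<and> closedin (ends_space X) A"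
      "\<And>F e. openin (ends_space X) F \<Longrightarrow> e \<in> F \<Longrightarrow> \<exists>A\<in>\<C>. e \<in> A \<and> A \<subseteq> F"
      using countable_clopen_base_ends by (elim exE conjE) simp
    have "topspace (ends_space X) \<noteq> {}" using three(1) by auto
    then show ?thesis
      by (rule homeomorphic_cantor_set[OF compact_ends_space Hausdorff_ends_space _ \<C> perfect])
  qed
  ultimately show ?thesis by blast
next
  case False
  have "ends X \<noteq> {}"
  proof
    assume "ends X = {}"
    then obtain L where L: "compactin X L" "topspace X \<subseteq> L"
      using ends_in_eq_empty_imp_bounded[of "topspace X"] by (auto simp: ends_in_topspace)
    then have "L = topspace X" using compactin_subset_topspace by blast
    then show False using noncompact L(1) by (simp add: compact_space_def)
  qed
  then obtain e1 where e1: "e1 \<in> ends X" by blast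
  show ?thesis
  proof (cases "ends X = {e1}")
    case True
    then show ?thesis by simp
  next
    case ne: False
    then obtain e2 where "e2 \<in> ends X" "e2 \<noteq> e1" using e1 by blast
    moreover have "e = e1 \<or> e = e2" if "e \<in> ends X" for e
      using False e1 \<open>e2 \<in> ends X\<close> \<open>e2 \<noteq> e1\<close> that by metis
    ultimately have "ends X = {e1, e2}" using e1 by blast
    then show ?thesis using \<open>e2 \<noteq> e1\<close> by simp
  qed
qed

end

section \<open>Finite unions of convergent sequences\<close>

lemma Hausdorff_finite_disjoint_nbhds:
  assumes "Hausdorff_space Y" "finite F" "F \<subseteq> topspace Y"
  shows "\<exists>V. (\<forall>x\<in>F. openin Y (V x) \<and> x \<in> V x) \<and> (\<forall>x\<in>F. \<forall>y\<in>F. x \<noteq> y \<longrightarrow> V x \<inter> V y = {})"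
  using assms(2,3)
proof (induction F)
  case (insert a F)
  then obtain V where V: "\<forall>x\<in>F. openin Y (V x) \<and> x \<in> V x" "\<forall>x\<in>F. \<forall>y\<in>F. x \<noteq> y \<longrightarrow> V x \<inter> V y = {}"
    by auto
  have "compactin Y {a}" "compactin Y F" "disjnt {a} F"
    using insert by (auto simp: disjnt_def finite_imp_compactin)
  then obtain P Q where PQ: "openin Y P" "openin Y Q" "a \<in> P" "F \<subseteq> Q" "P \<inter> Q = {}"
    using Hausdorff_space_compact_separation[OF assms(1)] by (metis disjnt_def insert_subset)
  let ?V = "\<lambda>x. if x = a then P else V x \<inter> Q"
  have "?V x \<inter> ?V y = {}" if "x \<in> insert a F" "y \<in> insert a F" "x \<noteq> y" for x y
    using that V(2) PQ(4,5) insert.hyps by auto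
  then show ?case using V(1) PQ by (intro exI[of _ ?V]) auto
qed simp

lemma compactin_isolated_imp_finite:
  assumes "compactin Y R" "\<And>x. x \<in> R \<Longrightarrow> openin Y {x}"
  shows "finite R"
proof -
  obtain \<F> where F: "finite \<F>" "\<F> \<subseteq> (\<lambda>x. {x}) ` R" "R \<subseteq> \<Union>\<F>"
    using compactinD[OF assms(1), of "(\<lambda>x. {x}) ` R"] assms(2) by auto
  have "finite (\<Union>\<F>)" using F(1,2) by (intro finite_Union) auto
  then show ?thesis using F(3) finite_subset by blast
qed

text \<open>Choose disjoint open neighbourhoods of the points of \<open>B\<close>. They contain all but finitely many
  points of \<open>U\<close>, since what they leave out is compact and discrete. So \<open>U\<close> is the disjoint union of
  countably infinite fibres, one over each point \<open>b\<close> of \<open>B\<close>, such that a neighbourhood of \<open>b\<close> meets only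
  the fibre of \<open>b\<close>, up to the finitely many leftover points. Enumerating the fibres gives a bijection
  onto \<open>Z\<close>. It is continuous at \<open>b\<close> because the sequence converges and finite sets are closed, and it
  is a homeomorphism since it goes from a compact to a Hausdorff space.\<close>

theorem homeomorphic_convergent_sequences:
  fixes l :: "'i \<Rightarrow> 'b" and s :: "'i \<Rightarrow> nat \<Rightarrow> 'b"
  assumes comp: "compact_space Y" and haus: "Hausdorff_space Y"
    and top: "topspace Y = B \<union> U" and disj: "B \<inter> U = {}"
    and "finite I" "I \<noteq> {}" and B: "finite B" "card I = card B"
    and "countable U" and iso: "\<And>u. u \<in> U \<Longrightarrow> openin Y {u}" and dense: "B \<subseteq> Y closure_of U"
    and hausZ: "Hausdorff_space Z"
    and topZ: "topspace Z = l ` I \<union> (\<Union>i\<in>I. range (s i))"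
    and inj_l: "inj_on l I" and inj_s: "inj_on (\<lambda>(i, n). s i n) (I \<times> UNIV)"
    and ls: "\<And>i j n. i \<in> I \<Longrightarrow> j \<in> I \<Longrightarrow> l i \<noteq> s j n"
    and lim: "\<And>i. i \<in> I \<Longrightarrow> limitin Z (s i) (l i) sequentially"
  shows "Y homeomorphic_space Z"
proof -
  obtain p where p: "bij_betw p B I"
    using finite_same_card_bij[OF B(1) \<open>finite I\<close>] B(2) by metis
  have "B \<noteq> {}" using B \<open>finite I\<close> \<open>I \<noteq> {}\<close> by auto
  then obtain b0 where b0: "b0 \<in> B" by blast
  obtain V where V: "\<And>b. b \<in> B \<Longrightarrow> openin Y (V b)" "\<And>b. b \<in> B \<Longrightarrow> b \<in> V b"
    "\<And>b c. b \<in> B \<Longrightarrow> c \<in> B \<Longrightarrow> b \<noteq> c \<Longrightarrow> V b \<inter> V c = {}"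
    using Hausdorff_finite_disjoint_nbhds[OF haus B(1)] top by (metis sup_ge1)
  have VB: "V b \<inter> B = {b}" if "b \<in> B" for b using V(2,3) that by blast
  define R where "R = topspace Y - (\<Union>b\<in>B. V b)"
  have RU: "R \<subseteq> U" unfolding R_def top using V(2) by blast
  have "closedin Y R" unfolding R_def using V(1) by blast
  then have "compactin Y R" using comp closedin_compact_space by blast
  then have finR: "finite R" using iso RU by (intro compactin_isolated_imp_finite) auto
  \<comment> \<open>The finitely many points of \<open>U\<close> outside all the neighbourhoods are given to \<open>b0\<close>.\<close>
  define fib where "fib b = (U \<inter> V b) \<union> (if b = b0 then R else {})" for b
  have fibU: "fib b \<subseteq> U" for b using RU by (auto simp: fib_def)
  have fib_cover: "\<exists>b\<in>B. u \<in> fib b" if "u \<in> U" for u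
    using that b0 by (cases "u \<in> R") (auto simp: fib_def R_def top)
  have fib_unique: "b = c" if "u \<in> fib b" "u \<in> fib c" "b \<in> B" "c \<in> B" for u b c
    using that V(3)[of b c] by (auto simp: fib_def R_def split: if_splits)
  have Vfin_open: "openin Y (V b - F)" if "b \<in> B" "finite F" "F \<subseteq> topspace Y" for b F
    using that V(1) haus by (intro openin_diff) (auto simp: closedin_Hausdorff_finite)
  have fib_inf: "infinite (fib b)" if b: "b \<in> B" for b
  proof
    assume "finite (fib b)"
    then have "finite (U \<inter> V b)" by (simp add: fib_def)
    then have "openin Y (V b - U \<inter> V b)" using Vfin_open[OF b] top by blast
    moreover have "b \<in> V b - U \<inter> V b" using V(2) b disj by blast
    moreover have "\<forall>T. b \<in> T \<and> openin Y T \<longrightarrow> (\<exists>u. u \<in> U \<and> u \<in> T)"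
      using subsetD[OF dense b] by (simp add: in_closure_of)
    ultimately have "\<exists>u. u \<in> U \<and> u \<in> V b - U \<inter> V b" by (metis (no_types))
    then show False by blast
  qed
  define r where "r u = (THE b. b \<in> B \<and> u \<in> fib b)" for u
  have r_eq: "r u = b" if "b \<in> B" "u \<in> fib b" for u b
    unfolding r_def
  proof (rule the_equality)
    show "b \<in> B \<and> u \<in> fib b" using that by simp
    show "c = b" if "c \<in> B \<and> u \<in> fib c" for c
      using fib_unique[of u c b] that \<open>b \<in> B\<close> \<open>u \<in> fib b\<close> by simp
  qed
  have r: "r u \<in> B" "u \<in> fib (r u)" if "u \<in> U" for u using fib_cover[OF that] r_eq by auto
  define N where "N u = to_nat_on (fib (r u)) u" for u
  have bij_fib: "bij_betw (to_nat_on (fib b)) (fib b) UNIV" if "b \<in> B" for b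
    using to_nat_on_infinite countable_subset[OF fibU \<open>countable U\<close>] fib_inf[OF that] by blast
  define F where "F y = (if y \<in> B then l (p y) else s (p (r y)) (N y))" for y
  have pI: "p b \<in> I" if "b \<in> B" for b using p that bij_betwE by blast
  have F_B: "F b = l (p b)" if "b \<in> B" for b using that by (simp add: F_def)
  have F_U: "F u = s (p (r u)) (N u)" if "u \<in> U" for u using that disj by (auto simp: F_def)
  have img: "F ` topspace Y = topspace Z"
  proof
    show "F ` topspace Y \<subseteq> topspace Z"
    proof (rule image_subsetI)
      fix y assume "y \<in> topspace Y"
      then consider "y \<in> B" | "y \<in> U" using top by blast
      then show "F y \<in> topspace Z"
        using F_B[of y] F_U[of y] pI[of y] pI[OF r(1)[of y]] unfolding topZ by cases auto
    qed
    show "topspace Z \<subseteq> F ` topspace Y"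
    proof
      fix z assume "z \<in> topspace Z"
      then consider i where "i \<in> I" "z = l i" | i n where "i \<in> I" "z = s i n" by (auto simp: topZ)
      then show "z \<in> F ` topspace Y"
      proof cases
        case 1
        then obtain b where b: "b \<in> B" "p b = i" using bij_betw_imp_surj_on[OF p] by blast
        have "F b = z" using F_B[OF b(1)] b(2) 1 by simp
        moreover have "b \<in> topspace Y" using b(1) top by blast
        ultimately show ?thesis by blast
      next
        case 2
        then obtain b where b: "b \<in> B" "p b = i" using bij_betw_imp_surj_on[OF p] by blast
        obtain u where u: "u \<in> fib b" "to_nat_on (fib b) u = n"
          using bij_betw_imp_surj_on[OF bij_fib[OF b(1)]] by (metis UNIV_I imageE)
        have "u \<in> U" using u(1) fibU by blast
        then have "F u = z" using F_U[of u] r_eq[OF b(1) u(1)] b(2) u(2) 2 by (simp add: N_def)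
        moreover have "u \<in> topspace Y" using \<open>u \<in> U\<close> top by blast
        ultimately show ?thesis by blast
      qed
    qed
  qed
  have inj: "inj_on F (topspace Y)"
  proof (rule inj_onI)
    fix x y assume xy: "x \<in> topspace Y" "y \<in> topspace Y" "F x = F y"
    have mixed: "F b \<noteq> F u" if "b \<in> B" "u \<in> U" for b u
      using ls[OF pI[OF that(1)] pI[OF r(1)[OF that(2)]]] F_B[OF that(1)] F_U[OF that(2)] by simp
    have BB: "x = y" if "x \<in> B" "y \<in> B"
    proof -
      have "p x = p y" using xy(3) F_B[OF that(1)] F_B[OF that(2)] pI that by (intro inj_onD[OF inj_l]) auto
      then show ?thesis using inj_onD[OF bij_betw_imp_inj_on[OF p]] that by blast
    qed
    have UU: "x = y" if U: "x \<in> U" "y \<in> U"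
    proof -
      have "(p (r x), N x) = (p (r y), N y)"
        using xy(3) F_U[OF U(1)] F_U[OF U(2)] pI r(1) U by (intro inj_onD[OF inj_s]) auto
      then have *: "r x = r y" "N x = N y" using bij_betw_imp_inj_on[OF p] r(1) U by (auto dest: inj_onD)
      then show ?thesis
        using bij_betw_imp_inj_on[OF bij_fib[OF r(1)[OF U(1)]]] r(2)[OF U(1)] r(2)[OF U(2)]
          * unfolding N_def by (metis inj_onD)
    qed
    consider "x \<in> B" "y \<in> B" | "x \<in> U" "y \<in> U" | "x \<in> B" "y \<in> U" | "x \<in> U" "y \<in> B"
      using xy top by blast
    then show "x = y"
    proof cases
      case 3 then show ?thesis using mixed[of x y] xy(3) by simp
    next
      case 4 then show ?thesis using mixed[of y x] xy(3) by simp
    qed (use BB UU in blast)+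
  qed
  have "topcontinuous_at Y Z F y" if y: "y \<in> topspace Y" for y
    unfolding topcontinuous_at_def
  proof (intro conjI allI impI y)
    show "F \<in> topspace Y \<rightarrow> topspace Z" using img by blast
    fix W assume W: "openin Z W \<and> F y \<in> W"
    show "\<exists>T. openin Y T \<and> y \<in> T \<and> (\<forall>x\<in>T. F x \<in> W)"
    proof (cases "y \<in> U")
      case True
      then show ?thesis using iso W by (intro exI[of _ "{y}"]) auto
    next
      case False
      then have yB: "y \<in> B" using y top by blast
      then have "\<forall>\<^sub>F n in sequentially. s (p y) n \<in> W"
        using lim[OF pI[OF yB]] W F_B by (auto simp: limitin_def)
      then obtain M where M: "\<And>n. n \<ge> M \<Longrightarrow> s (p y) n \<in> W" by (auto simp: eventually_sequentially)
      define E where "E = {u \<in> fib y. to_nat_on (fib y) u < M}"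
      have "inj_on (to_nat_on (fib y)) E"
        using bij_betw_imp_inj_on[OF bij_fib[OF yB]] by (rule inj_on_subset) (auto simp: E_def)
      moreover have "to_nat_on (fib y) ` E \<subseteq> {..<M}" by (auto simp: E_def)
      ultimately have "finite E" by (meson finite_lessThan inj_on_finite)
      have EU: "E \<subseteq> U" using fibU by (auto simp: E_def)
      show ?thesis
      proof (intro exI[of _ "V y - E"] conjI ballI)
        show "openin Y (V y - E)" using Vfin_open[OF yB \<open>finite E\<close>] EU top by blast
        show "y \<in> V y - E" using V(2)[OF yB] EU False by blast
        fix x assume x: "x \<in> V y - E"
        show "F x \<in> W"
        proof (cases "x \<in> U")
          case True
          then have xf: "x \<in> fib y" using x by (auto simp: fib_def)
          then have "to_nat_on (fib y) x \<ge> M" using x by (auto simp: E_def)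
          then show ?thesis using M F_U[OF True] r_eq[OF yB xf] by (simp add: N_def)
        next
          case False
          then have "x \<in> B" using x openin_subset[OF V(1)[OF yB]] top by blast
          then have "x = y" using VB[OF yB] x by blast
          then show ?thesis using W by simp
        qed
      qed
    qed
  qed
  then have "continuous_map Y Z F" by (simp add: continuous_map_eq_topcontinuous_at)
  then have "homeomorphic_map Y Z F" using comp hausZ img inj by (intro continuous_imp_homeomorphic_map)
  then show ?thesis by (rule homeomorphic_map_imp_homeomorphic_space)
qed

lemma harmonic_LIMSEQ: "(\<lambda>n. 1 / real (Suc n)) \<longlonglongrightarrow> 0"
  using LIMSEQ_inverse_real_of_nat by (simp add: inverse_eq_divide)

lemma closure_harmonic: "closure {1 / real n | n. n \<ge> 1} = insert 0 (range (\<lambda>n. 1 / real (Suc n)))"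
proof -
  have eq: "{1 / real n | n. n \<ge> 1} = range (\<lambda>n. 1 / real (Suc n))"
  proof (intro equalityI subsetI)
    fix x assume "x \<in> {1 / real n | n. n \<ge> 1}"
    then obtain n where "n \<ge> 1" "x = 1 / real n" by blast
    then show "x \<in> range (\<lambda>n. 1 / real (Suc n))" by (intro image_eqI[of _ _ "n - 1"]) auto
  next
    fix x assume "x \<in> range (\<lambda>n. 1 / real (Suc n))"
    then obtain n where "x = 1 / real (Suc n)" by blast
    then show "x \<in> {1 / real n | n. n \<ge> 1}" by (intro CollectI exI[of _ "Suc n"]) auto
  qed
  have "closed (insert 0 (range (\<lambda>n. 1 / real (Suc n))))"
    by (rule compact_imp_closed[OF compact_sequence_with_limit[OF harmonic_LIMSEQ]])
  moreover have "0 \<in> closure (range (\<lambda>n. 1 / real (Suc n)))"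
    unfolding closure_sequential by (intro exI[of _ "\<lambda>n. 1 / real (Suc n)"] conjI harmonic_LIMSEQ) blast
  moreover have "range (\<lambda>n. 1 / real (Suc n)) \<subseteq> closure (range (\<lambda>n. 1 / real (Suc n)))"
    by (rule closure_subset)
  ultimately show ?thesis unfolding eq by (intro equalityI closure_minimal insert_subsetI subset_insertI)
qed

lemma topspace_harmonic_closure: "topspace harmonic_closure = insert 0 (range (\<lambda>n. 1 / real (Suc n)))"
  unfolding harmonic_closure_def closure_harmonic by simp

lemma limitin_harmonic_closure: "limitin harmonic_closure (\<lambda>n. 1 / real (Suc n)) 0 sequentially"
  unfolding harmonic_closure_def closure_harmonic limitin_subtopology
  using harmonic_LIMSEQ by (auto intro: always_eventually simp del: of_nat_Suc)

lemma Hausdorff_harmonic_closure: "Hausdorff_space harmonic_closure"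
  by (simp add: harmonic_closure_def Hausdorff_space_subtopology)

lemma homeomorphic_harmonic_closure:
  assumes "compact_space Y" "Hausdorff_space Y" "topspace Y = B \<union> U" "B \<inter> U = {}" "card B = 1"
    "countable U" "\<And>u. u \<in> U \<Longrightarrow> openin Y {u}" "B \<subseteq> Y closure_of U"
  shows "Y homeomorphic_space harmonic_closure"
proof (rule homeomorphic_convergent_sequences[where I = "{()}" and l = "\<lambda>_. 0" and s = "\<lambda>_ n. 1 / real (Suc n)"])
  show "finite B" using assms(5) card_ge_0_finite[of B] by simp
  show "inj_on (\<lambda>(i, n). 1 / real (Suc n)) ({()} \<times> UNIV)" by (auto simp: inj_on_def)
  show "limitin harmonic_closure (\<lambda>n. 1 / real (Suc n)) 0 sequentially" by (rule limitin_harmonic_closure)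
qed (use assms in \<open>auto simp: topspace_harmonic_closure Hausdorff_harmonic_closure\<close>)

lemma homeomorphic_two_harmonic_closures:
  assumes "compact_space Y" "Hausdorff_space Y" "topspace Y = B \<union> U" "B \<inter> U = {}" "card B = 2"
    "countable U" "\<And>u. u \<in> U \<Longrightarrow> openin Y {u}" "B \<subseteq> Y closure_of U"
  shows "Y homeomorphic_space sum_topology (\<lambda>_. harmonic_closure) (UNIV :: bool set)"
proof (rule homeomorphic_convergent_sequences[where I = "UNIV :: bool set" and l = "\<lambda>i. (i, 0)"
      and s = "\<lambda>i n. (i, 1 / real (Suc n))"])
  let ?Z = "sum_topology (\<lambda>_. harmonic_closure) (UNIV :: bool set)"
  show "finite B" using assms(5) card_ge_0_finite[of B] by simp
  show "Hausdorff_space ?Z"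
    unfolding Hausdorff_space_def
  proof (intro allI impI)
    fix x y assume xy: "x \<in> topspace ?Z \<and> y \<in> topspace ?Z \<and> x \<noteq> y"
    obtain i a j b where [simp]: "x = (i, a)" "y = (j, b)" by (cases x, cases y)
    have top: "a \<in> topspace harmonic_closure" "b \<in> topspace harmonic_closure" using xy by auto
    have op: "openin ?Z ({i} \<times> T)" if "openin harmonic_closure T" for i T
    proof -
      have "{i} \<times> T = (\<lambda>x. (i, x)) ` T" by auto
      then show ?thesis
        using that open_map_component_injection[of i UNIV "\<lambda>_. harmonic_closure"] by (simp add: open_map_def)
    qed
    show "\<exists>P Q. openin ?Z P \<and> openin ?Z Q \<and> x \<in> P \<and> y \<in> Q \<and> disjnt P Q"
    proof (cases "i = j")
      case True
      then have "a \<noteq> b" using xy by simp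
      then obtain P Q where "openin harmonic_closure P" "openin harmonic_closure Q" "a \<in> P" "b \<in> Q" "disjnt P Q"
        using Hausdorff_harmonic_closure top unfolding Hausdorff_space_def by blast
      then show ?thesis using op
        by (intro exI[of _ "{i} \<times> P"] exI[of _ "{j} \<times> Q"]) (auto simp: disjnt_iff)
    next
      case False
      then show ?thesis using op[OF openin_topspace] top
        by (intro exI[of _ "{i} \<times> topspace harmonic_closure"] exI[of _ "{j} \<times> topspace harmonic_closure"])
          (auto simp: disjnt_iff)
    qed
  qed
  show "limitin ?Z (\<lambda>n. (i, 1 / real (Suc n))) (i, 0) sequentially" for i
    using continuous_map_limit[OF continuous_map_component_injection[of i UNIV "\<lambda>_. harmonic_closure"]
        limitin_harmonic_closure]
    by (simp add: o_def)
qed (use assms in \<open>auto simp: topspace_harmonic_closure inj_on_def\<close>)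

lemma topspace_ordinal_space: "topspace (ordinal_space \<alpha>) = ordinal_set \<alpha>"
  unfolding ordinal_space_def topology_generated_by_topspace by auto

lemma ordinal_less_simp [simp]: "((a, m), (b, n)) \<in> ordinal_less \<longleftrightarrow> a < b \<or> a = b \<and> m < n"
  by (auto simp: ordinal_less_def)

lemma openin_ordinal_rays:
  assumes "\<delta> \<in> ordinal_set \<alpha>"
  shows "openin (ordinal_space \<alpha>) {\<beta> \<in> ordinal_set \<alpha>. (\<beta>, \<delta>) \<in> ordinal_less}"
    and "openin (ordinal_space \<alpha>) {\<beta> \<in> ordinal_set \<alpha>. (\<delta>, \<beta>) \<in> ordinal_less}"
  unfolding ordinal_space_def using assms by (blast intro: topology_generated_by_Basis)+

lemma Hausdorff_ordinal_space: "Hausdorff_space (ordinal_space \<alpha>)"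
proof -
  have sep: "\<exists>P Q. openin (ordinal_space \<alpha>) P \<and> openin (ordinal_space \<alpha>) Q \<and> x \<in> P \<and> y \<in> Q \<and> disjnt P Q"
    if xy: "x \<in> ordinal_set \<alpha>" "y \<in> ordinal_set \<alpha>" "(x, y) \<in> ordinal_less" for x y
  proof -
    obtain a m b n c k where [simp]: "x = (a, m)" "y = (b, n)" "\<alpha> = (c, k)" by (cases x, cases y, cases \<alpha>)
    have "(a, Suc m) \<in> ordinal_set \<alpha>" using xy by (auto simp: ordinal_set_def)
    then show ?thesis using openin_ordinal_rays(1)[of "(a, Suc m)" \<alpha>] openin_ordinal_rays(2)[OF xy(1)] xy
      by (intro exI[of _ "{\<beta> \<in> ordinal_set \<alpha>. (\<beta>, (a, Suc m)) \<in> ordinal_less}"]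
          exI[of _ "{\<beta> \<in> ordinal_set \<alpha>. (x, \<beta>) \<in> ordinal_less}"]) (auto simp: disjnt_iff)
  qed
  have linear: "(x, y) \<in> ordinal_less \<or> (y, x) \<in> ordinal_less" if "x \<noteq> y" for x y
    using that by (cases x, cases y) auto
  show ?thesis unfolding Hausdorff_space_def topspace_ordinal_space
    using sep linear by (meson disjnt_sym)
qed

text \<open>The shift \<open>k\<close> allows for sequences that start after a limit ordinal.\<close>

lemma limitin_ordinal_space:
  assumes "(Suc i, 0) \<in> ordinal_set \<alpha>"
  shows "limitin (ordinal_space \<alpha>) (\<lambda>n. (i, n + k)) (Suc i, 0) sequentially"
  unfolding limitin_def topspace_ordinal_space
proof (intro conjI assms allI impI)
  obtain c d where [simp]: "\<alpha> = (c, d)" by (cases \<alpha>)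
  have below: "(i, n) \<in> ordinal_set \<alpha>" for n using assms by (auto simp: ordinal_set_def)
  fix W assume W: "openin (ordinal_space \<alpha>) W \<and> (Suc i, 0) \<in> W"
  then have "generate_topology_on ({ordinal_set \<alpha>} \<union>
      {{\<beta> \<in> ordinal_set \<alpha>. (\<beta>, \<delta>) \<in> ordinal_less} | \<delta>. \<delta> \<in> ordinal_set \<alpha>} \<union>
      {{\<beta> \<in> ordinal_set \<alpha>. (\<delta>, \<beta>) \<in> ordinal_less} | \<delta>. \<delta> \<in> ordinal_set \<alpha>}) W"
    unfolding ordinal_space_def openin_topology_generated_by_iff by blast
  then have "(Suc i, 0) \<in> W \<longrightarrow> (\<forall>\<^sub>F n in sequentially. (i, n + k) \<in> W)"
  proof induction
    case (Int a b) then show ?case by (auto intro: eventually_conj)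
  next
    case (UN K)
    show ?case
    proof
      assume "(Suc i, 0) \<in> \<Union>K"
      then obtain w where w: "w \<in> K" "(Suc i, 0) \<in> w" by blast
      then have "\<forall>\<^sub>F n in sequentially. (i, n + k) \<in> w" using UN.IH by blast
      then show "\<forall>\<^sub>F n in sequentially. (i, n + k) \<in> \<Union>K" by (rule eventually_mono) (use w in blast)
    qed
  next
    case (Basis w)
    show ?case
    proof
      assume w: "(Suc i, 0) \<in> w"
      consider "w = ordinal_set \<alpha>"
        | a m where "w = {\<beta> \<in> ordinal_set \<alpha>. (\<beta>, (a, m)) \<in> ordinal_less}"
        | a m where "w = {\<beta> \<in> ordinal_set \<alpha>. ((a, m), \<beta>) \<in> ordinal_less}"
        using Basis by auto
      then show "\<forall>\<^sub>F n in sequentially. (i, n + k) \<in> w"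
      proof cases
        case 1 then show ?thesis using below by simp
      next
        case 2 then show ?thesis using below w by auto
      next
        case 3
        have "(i, n + k) \<in> w" if "n \<ge> Suc m" for n using 3 below w that by auto
        then show ?thesis by (auto simp: eventually_sequentially)
      qed
    qed
  qed simp
  then show "\<forall>\<^sub>F n in sequentially. (i, n + k) \<in> W" using W by blast
qed

text \<open>The ordinal \<open>\<omega> \<cdot> m + 1\<close> consists of the limits \<open>\<omega> \<cdot> (i + 1)\<close> for \<open>i < m\<close>, each with the
  sequence \<open>\<omega> \<cdot> i + n\<close> that converges to it. For \<open>i > 0\<close> the term \<open>n = 0\<close> is left out, since it is
  the limit of the preceding sequence.\<close>

lemma homeomorphic_ordinal_space:
  assumes "compact_space Y" "Hausdorff_space Y" "topspace Y = B \<union> U" "B \<inter> U = {}" "card B = m" "m > 0"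
    "countable U" "\<And>u. u \<in> U \<Longrightarrow> openin Y {u}" "B \<subseteq> Y closure_of U"
  shows "Y homeomorphic_space ordinal_space (m, 1)"
proof (rule homeomorphic_convergent_sequences[where I = "{..<m}" and l = "\<lambda>i. (Suc i, 0)"
      and s = "\<lambda>i n. (i, n + (if i = 0 then 0 else 1))"])
  show "finite B" using assms(5,6) card_gt_0_iff by blast
  show "topspace (ordinal_space (m, 1)) =
      (\<lambda>i. (Suc i, 0)) ` {..<m} \<union> (\<Union>i<m. range (\<lambda>n. (i, n + (if i = 0 then 0 else 1))))" (is "_ = ?R")
  proof
    show "topspace (ordinal_space (m, 1)) \<subseteq> ?R"
    proof
      fix x assume "x \<in> topspace (ordinal_space (m, 1))"
      then obtain a n where x: "x = (a, n)" "a < m \<or> a = m \<and> n = 0"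
        by (cases x) (auto simp: topspace_ordinal_space ordinal_set_def)
      show "x \<in> ?R"
      proof (cases "n = 0 \<and> a > 0")
        case True
        then show ?thesis using x by (intro UnI1 image_eqI[of _ _ "a - 1"]) auto
      next
        case False
        then have "x = (a, (if a = 0 then n else n - 1) + (if a = 0 then 0 else 1))" "a < m"
          using x \<open>m > 0\<close> by auto
        then show ?thesis by blast
      qed
    qed
    show "?R \<subseteq> topspace (ordinal_space (m, 1))" by (auto simp: topspace_ordinal_space ordinal_set_def)
  qed
  show "limitin (ordinal_space (m, 1)) (\<lambda>n. (i, n + (if i = 0 then 0 else 1))) (Suc i, 0) sequentially"
    if "i \<in> {..<m}" for i
    using that by (intro limitin_ordinal_space) (auto simp: ordinal_set_def)
qed (use assms in \<open>auto simp: Hausdorff_ordinal_space inj_on_def\<close>)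

section \<open>Cayley graphs\<close>

locale finitely_generated_group = group G for G (structure) +
  fixes H
  assumes gen: "finite_generating_set G H"
begin

text \<open>The points of the geometric realization are handled through the predicate \<open>on_edge u v\<close>; a
  vertex counts as a degenerate edge from itself to itself.\<close>

definition edge :: "'a \<Rightarrow> 'a \<Rightarrow> bool" where
  "edge u v \<longleftrightarrow> u \<in> carrier G \<and> v \<in> carrier G \<and> (u = v \<or> cayley_adjacent G H u v)"

definition on_edge :: "'a \<Rightarrow> 'a \<Rightarrow> ('a \<Rightarrow> real) \<Rightarrow> bool" where
  "on_edge u v f \<longleftrightarrow> (\<forall>w. 0 \<le> f w) \<and> (\<forall>w. w \<notin> {u, v} \<longrightarrow> f w = 0) \<and> (\<Sum>w\<in>{u, v}. f w) = 1"

definition vertex :: "'a \<Rightarrow> 'a \<Rightarrow> real" where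
  "vertex u = (\<lambda>w. if w = u then 1 else 0)"

definition mix :: "('a \<Rightarrow> real) \<Rightarrow> ('a \<Rightarrow> real) \<Rightarrow> real \<Rightarrow> 'a \<Rightarrow> real" where
  "mix f g s = (\<lambda>w. (1 - s) * f w + s * g w)"

primrec word_ball :: "nat \<Rightarrow> 'a set" where
  "word_ball 0 = {\<one>}"
| "word_ball (Suc n) = word_ball n \<union> (\<lambda>(u, h). u \<otimes> h) ` (word_ball n \<times> H)"

definition graph_ball :: "nat \<Rightarrow> ('a \<Rightarrow> real) set" where
  "graph_ball n = {f \<in> cayley_points G H. \<forall>w. f w \<noteq> 0 \<longrightarrow> w \<in> word_ball n}"

abbreviation "X \<equiv> cayley_graph G H"

lemma H_props: "finite H" "H \<subseteq> carrier G" "h \<in> H \<Longrightarrow> inv h \<in> H" "generate G H = carrier G"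
  using gen by (auto simp: finite_generating_set_def)

lemma topspace_X: "topspace X = cayley_points G H"
  by (simp add: cayley_graph_def)

lemma cayley_points_iff: "f \<in> cayley_points G H \<longleftrightarrow> (\<exists>u v. edge u v \<and> on_edge u v f)"
  unfolding cayley_points_def edge_def on_edge_def by blast

lemma edge_sym: assumes "edge u v" shows "edge v u"
proof (cases "u = v")
  case False
  then obtain h where h: "h \<in> H" "u \<otimes> h = v" and c: "u \<in> carrier G" "v \<in> carrier G"
    using assms by (auto simp: edge_def cayley_adjacent_def)
  have "v \<otimes> inv h = u" using h c H_props(2) by (metis inv_solve_right subsetD)
  then show ?thesis using H_props(3)[OF h(1)] c by (auto simp: edge_def cayley_adjacent_def)
qed (use assms in simp)

lemma on_edge_commute: "on_edge u v f \<longleftrightarrow> on_edge v u f"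
  by (simp add: on_edge_def insert_commute)

lemma on_edge_pos: "on_edge u v f \<Longrightarrow> f w \<noteq> 0 \<Longrightarrow> 0 < f w"
  unfolding on_edge_def by (metis order_le_less)

lemma on_edge_support: "on_edge u v f \<Longrightarrow> f w \<noteq> 0 \<Longrightarrow> w = u \<or> w = v"
  unfolding on_edge_def by blast

lemma on_edge_exists_pos: "on_edge u v f \<Longrightarrow> \<exists>w. f w > 0"
  using on_edge_pos unfolding on_edge_def by (metis sum.neutral zero_neq_one)

lemma cayley_points_exists_pos: "f \<in> cayley_points G H \<Longrightarrow> \<exists>w. f w > 0"
  unfolding cayley_points_iff using on_edge_exists_pos by blast

lemma on_edge_vertex: "on_edge u v (vertex u)" "on_edge u v (vertex v)"
  by (auto simp: on_edge_def vertex_def sum.insert_if)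

lemma on_edge_degenerate:
  assumes "on_edge u v f" "f v = 0" shows "f = vertex u"
proof
  fix w
  have "f u = 1" using assms by (auto simp: on_edge_def sum.insert_if split: if_splits)
  then show "f w = vertex u w" using on_edge_support[OF assms(1), of w] assms(2) by (auto simp: vertex_def)
qed

lemma on_edge_mix:
  assumes "on_edge u v f" "on_edge u v g" "0 \<le> s" "s \<le> 1" shows "on_edge u v (mix f g s)"
  using assms unfolding on_edge_def mix_def
  by (auto simp: sum.distrib simp flip: sum_distrib_left)

lemma word_ball_finite: "finite (word_ball n)"
  by (induction n) (auto simp: H_props)

lemma word_ball_carrier: "word_ball n \<subseteq> carrier G"
  by (induction n) (use H_props(2) in auto)

lemma word_ball_mono: "m \<le> n \<Longrightarrow> word_ball m \<subseteq> word_ball n"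
  by (rule lift_Suc_mono_le) auto

lemma word_ball_edge: "u \<in> word_ball n \<Longrightarrow> edge u v \<Longrightarrow> v \<in> word_ball (Suc n)"
  by (force simp: edge_def cayley_adjacent_def)

lemma Union_word_ball: "(\<Union>n. word_ball n) = carrier G"
proof
  show "(\<Union>n. word_ball n) \<subseteq> carrier G" using word_ball_carrier by blast
  have step: "x \<otimes> h \<in> (\<Union>n. word_ball n)" if x: "x \<in> (\<Union>n. word_ball n)" and h: "h \<in> H" for x h
  proof -
    obtain n where "x \<in> word_ball n" using x by blast
    then have "x \<otimes> h \<in> word_ball (Suc n)" using h by auto
    then show ?thesis by blast
  qed
  have "\<forall>x\<in>(\<Union>n. word_ball n). x \<otimes> g \<in> (\<Union>n. word_ball n)" if "g \<in> generate G H" for g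
    using that
  proof induction
    case one
    then show ?case using word_ball_carrier by (metis UN_E r_one subsetD)
  next
    case (incl h) then show ?case using step by blast
  next
    case (inv h) then show ?case using step H_props(3) by blast
  next
    case (eng a b)
    show ?case
    proof
      fix x assume x: "x \<in> (\<Union>n. word_ball n)"
      have "(x \<otimes> a) \<otimes> b \<in> (\<Union>n. word_ball n)" using x eng.IH by blast
      moreover have "x \<in> carrier G" "a \<in> carrier G" "b \<in> carrier G"
        using x word_ball_carrier eng.hyps H_props(4) by auto
      ultimately show "x \<otimes> (a \<otimes> b) \<in> (\<Union>n. word_ball n)" by (simp add: m_assoc)
    qed
  qed
  moreover have "\<one> \<in> (\<Union>n. word_ball n)" by (rule UN_I[of 0]) auto
  ultimately show "carrier G \<subseteq> (\<Union>n. word_ball n)" using H_props(4) by (metis l_one subsetI)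
qed

lemma finite_subset_word_ball:
  assumes "finite F" "F \<subseteq> carrier G" shows "\<exists>n. F \<subseteq> word_ball n"
  using assms
proof (induction F)
  case (insert x F)
  then obtain n where n: "F \<subseteq> word_ball n" by auto
  have "x \<in> (\<Union>n. word_ball n)" using insert.prems Union_word_ball by blast
  then obtain m where "x \<in> word_ball m" by blast
  with n have "insert x F \<subseteq> word_ball (max n m)"
    using word_ball_mono[of n "max n m"] word_ball_mono[of m "max n m"] by auto
  then show ?case by blast
qed simp

lemma Hausdorff_X: "Hausdorff_space X"
  unfolding cayley_graph_def by (intro Hausdorff_space_subtopology) (simp add: Hausdorff_space_product_topology)

lemma continuous_coordinate: "continuous_map X euclideanreal (\<lambda>f. f w)"
  unfolding cayley_graph_def
  by (intro continuous_map_from_subtopology continuous_map_product_projection) simp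

lemma continuous_into_X:
  assumes "\<And>w. continuous_map T euclideanreal (\<lambda>x. F x w)" "F \<in> topspace T \<rightarrow> cayley_points G H"
  shows "continuous_map T X F"
  unfolding cayley_graph_def continuous_map_in_subtopology
  using assms by (auto simp: continuous_map_componentwise_UNIV)

lemma openin_coordinate:
  "open A \<Longrightarrow> openin X {g \<in> cayley_points G H. g w \<in> A}"
  using openin_continuous_map_preimage[OF continuous_coordinate, of A w] by (simp add: topspace_X)

lemma continuous_mix:
  assumes "edge u v" "on_edge u v f" "on_edge u v g"
  shows "continuous_map (top_of_set {0..1}) X (mix f g)"
proof (rule continuous_into_X)
  show "continuous_map (top_of_set {0..1}) euclideanreal (\<lambda>s. mix f g s w)" for w
    unfolding mix_def by (simp add: continuous_on_add continuous_on_mult continuous_on_diff)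
  show "mix f g \<in> topspace (top_of_set {0..1}) \<rightarrow> cayley_points G H"
  proof
    fix s :: real assume "s \<in> topspace (top_of_set {0..1})"
    then have "on_edge u v (mix f g s)" using on_edge_mix[OF assms(2,3)] by simp
    then show "mix f g s \<in> cayley_points G H" using assms(1) cayley_points_iff by blast
  qed
qed

lemma connectedin_mix:
  assumes "edge u v" "on_edge u v f" "on_edge u v g"
  shows "connectedin X (mix f g ` {0..1})"
  using connectedin_continuous_map_image[OF continuous_mix[OF assms], of "{0..1}"]
  by (simp add: connectedin_subtopology)

lemma compactin_mix:
  assumes "edge u v" "on_edge u v f" "on_edge u v g"
  shows "compactin X (mix f g ` {0..1})"
  using image_compactin[OF _ continuous_mix[OF assms], of "{0..1}"]
  by (simp add: compactin_subtopology)

lemma mix_endpoints: "f \<in> mix f g ` {0..1}" "g \<in> mix f g ` {0..1}"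
  by (auto simp: mix_def intro: image_eqI[of _ _ 0] image_eqI[of _ _ 1])

lemma edge_refl: "u \<in> carrier G \<Longrightarrow> edge u u"
  by (simp add: edge_def)

lemma vertex_in_cayley_points: "u \<in> carrier G \<Longrightarrow> vertex u \<in> cayley_points G H"
  using edge_refl on_edge_vertex cayley_points_iff by blast

lemma vertex_in_graph_ball: "u \<in> word_ball n \<Longrightarrow> vertex u \<in> graph_ball n"
  using vertex_in_cayley_points word_ball_carrier by (auto simp: graph_ball_def vertex_def)

lemma mix_in_graph_ball:
  assumes "edge u v" "on_edge u v f" "on_edge u v g" "f \<in> graph_ball n" "g \<in> graph_ball n"
  shows "mix f g ` {0..1} \<subseteq> graph_ball n"
proof
  fix k assume "k \<in> mix f g ` {0..1}"
  then obtain s where s: "0 \<le> s" "s \<le> 1" "k = mix f g s" by auto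
  have "k \<in> cayley_points G H" using on_edge_mix[OF assms(2,3)] s assms(1) cayley_points_iff by blast
  moreover have "w \<in> word_ball n" if "k w \<noteq> 0" for w
  proof -
    have "f w \<noteq> 0 \<or> g w \<noteq> 0" using that s(3) by (auto simp: mix_def)
    then show ?thesis using assms(4,5) by (auto simp: graph_ball_def)
  qed
  ultimately show "k \<in> graph_ball n" by (simp add: graph_ball_def)
qed

lemma compactin_graph_ball: "compactin X (graph_ball n)"
proof -
  let ?I = "{(u, v) \<in> word_ball n \<times> word_ball n. edge u v}"
  let ?S = "\<lambda>(u, v). mix (vertex u) (vertex v) ` {0..1}"
  have "graph_ball n = \<Union>(?S ` ?I)"
  proof
    show "graph_ball n \<subseteq> \<Union>(?S ` ?I)"
    proof
      fix f assume f: "f \<in> graph_ball n"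
      then obtain u v where uv: "edge u v" "on_edge u v f" by (auto simp: graph_ball_def cayley_points_iff)
      have deg: "f \<in> \<Union>(?S ` ?I)" if "edge u v" "on_edge u v f" "f v = 0" for u v
      proof -
        have "f = vertex u" by (rule on_edge_degenerate[OF that(2,3)])
        then have "u \<in> word_ball n" using f by (auto simp: graph_ball_def vertex_def)
        then have "(u, u) \<in> ?I" using edge_refl word_ball_carrier by auto
        then show ?thesis using mix_endpoints(1)[of "vertex u" "vertex u"] \<open>f = vertex u\<close> by blast
      qed
      show "f \<in> \<Union>(?S ` ?I)"
      proof (cases "f u = 0 \<or> f v = 0")
        case True
        then show ?thesis using deg[OF uv] deg[OF edge_sym[OF uv(1)]] uv(2) on_edge_commute by blast
      next
        case False
        then have I: "(u, v) \<in> ?I" using f uv by (auto simp: graph_ball_def)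
        show ?thesis
        proof (cases "u = v")
          case True
          then have "f = vertex u" using uv(2) unfolding on_edge_def vertex_def fun_eq_iff by auto
          then show ?thesis using I mix_endpoints(1)[of "vertex u" "vertex v"] by blast
        next
          case ne: False
          have "f u + f v = 1" using uv(2) ne by (simp add: on_edge_def)
          then have "f = mix (vertex u) (vertex v) (f v)"
            using uv(2) ne unfolding on_edge_def mix_def vertex_def fun_eq_iff by auto
          moreover have "f v \<in> {0..1}"
            using uv(2) \<open>f u + f v = 1\<close> unfolding on_edge_def by (metis atLeastAtMost_iff le_add_same_cancel2)
          ultimately show ?thesis using I by blast
        qed
      qed
    qed
    show "\<Union>(?S ` ?I) \<subseteq> graph_ball n"
    proof (rule UN_least)
      fix x assume "x \<in> ?I"
      then obtain u v where uv: "x = (u, v)" "u \<in> word_ball n" "v \<in> word_ball n" "edge u v" by blast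
      then show "?S x \<subseteq> graph_ball n"
        using mix_in_graph_ball[OF uv(4) on_edge_vertex] vertex_in_graph_ball by simp
    qed
  qed
  moreover have "finite ?I" by (rule finite_subset[of _ "word_ball n \<times> word_ball n"]) (auto simp: word_ball_finite)
  then have "compactin X (\<Union>(?S ` ?I))"
    using compactin_mix[OF _ on_edge_vertex] by (intro compactin_Union) auto
  ultimately show ?thesis by simp
qed

text \<open>A point of the ball has a positive coordinate at some \<open>u\<close> in the word ball. The open star of \<open>u\<close>
  consists of points on edges at \<open>u\<close>, whose other end points are in the next larger word ball.\<close>

lemma graph_ball_subset_interior: "graph_ball n \<subseteq> X interior_of graph_ball (Suc n)"
proof
  fix f assume f: "f \<in> graph_ball n"
  then obtain u where u: "f u > 0" using cayley_points_exists_pos by (auto simp: graph_ball_def)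
  then have uB: "u \<in> word_ball n" using f by (auto simp: graph_ball_def)
  let ?S = "{g \<in> cayley_points G H. g u \<in> {0<..}}"
  have "?S \<subseteq> graph_ball (Suc n)"
  proof
    fix g assume g: "g \<in> ?S"
    then obtain a b where ab: "edge a b" "on_edge a b g" by (auto simp: cayley_points_iff)
    then have "u = a \<or> u = b" using g on_edge_support[OF ab(2), of u] by auto
    then have "a \<in> word_ball (Suc n)" "b \<in> word_ball (Suc n)"
      using word_ball_edge[OF uB] ab(1) edge_sym[OF ab(1)] uB by auto
    then show "g \<in> graph_ball (Suc n)" using g on_edge_support[OF ab(2)] by (auto simp: graph_ball_def)
  qed
  moreover have "openin X ?S" by (rule openin_coordinate) simp
  moreover have "f \<in> ?S" using f u by (simp add: graph_ball_def)
  ultimately show "f \<in> X interior_of graph_ball (Suc n)" using interior_of_maximal by blast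
qed

lemma Union_graph_ball: "(\<Union>n. graph_ball n) = topspace X"
proof
  show "(\<Union>n. graph_ball n) \<subseteq> topspace X" by (auto simp: graph_ball_def topspace_X)
  show "topspace X \<subseteq> (\<Union>n. graph_ball n)"
  proof
    fix f assume f: "f \<in> topspace X"
    then obtain u v where uv: "edge u v" "on_edge u v f" by (auto simp: topspace_X cayley_points_iff)
    obtain n where "{u, v} \<subseteq> word_ball n"
      using finite_subset_word_ball[of "{u, v}"] uv(1) by (auto simp: edge_def)
    then have "f \<in> graph_ball n" using f on_edge_support[OF uv(2)] by (auto simp: graph_ball_def topspace_X)
    then show "f \<in> (\<Union>n. graph_ball n)" by blast
  qed
qed

text \<open>Follow the letters of a word from the neutral element to \<open>u\<close>, then the edge from \<open>u\<close> to \<open>f\<close>.\<close>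

lemma graph_ball_join:
  assumes "f \<in> graph_ball n"
  shows "\<exists>T. connectedin X T \<and> T \<subseteq> graph_ball n \<and> vertex \<one> \<in> T \<and> f \<in> T"
proof -
  have vert: "\<exists>T. connectedin X T \<and> T \<subseteq> graph_ball n \<and> vertex \<one> \<in> T \<and> vertex u \<in> T" if "u \<in> word_ball n" for u
    using that
  proof (induction n arbitrary: u)
    case 0
    then have "u = \<one>" by simp
    then show ?case using vertex_in_graph_ball[OF 0] vertex_in_cayley_points[of \<one>]
      by (intro exI[of _ "{vertex \<one>}"]) (auto simp: topspace_X)
  next
    case (Suc n)
    have mono: "graph_ball n \<subseteq> graph_ball (Suc n)" by (auto simp: graph_ball_def)
    show ?case
    proof (cases "u \<in> word_ball n")
      case True
      then show ?thesis using Suc.IH mono by (meson subset_trans)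
    next
      case False
      then obtain a h where a: "a \<in> word_ball n" "h \<in> H" "u = a \<otimes> h" using Suc.prems by auto
      obtain T where T: "connectedin X T" "T \<subseteq> graph_ball n" "vertex \<one> \<in> T" "vertex a \<in> T"
        using Suc.IH[OF a(1)] by blast
      have e: "edge a u"
        using a word_ball_carrier H_props(2) by (auto simp: edge_def cayley_adjacent_def)
      let ?M = "mix (vertex a) (vertex u) ` {0..1}"
      have "connectedin X ?M" by (rule connectedin_mix[OF e on_edge_vertex])
      then have "connectedin X (T \<union> ?M)"
        using connectedin_Un[OF T(1)] T(4) mix_endpoints(1)[of "vertex a" "vertex u"] by blast
      moreover have "?M \<subseteq> graph_ball (Suc n)"
        using a(1) Suc.prems by (intro mix_in_graph_ball[OF e on_edge_vertex] vertex_in_graph_ball) auto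
      ultimately show ?thesis
        using T(2,3) mono mix_endpoints(2)[of "vertex u" "vertex a"] by (intro exI[of _ "T \<union> ?M"]) blast
    qed
  qed
  obtain a b where ab: "edge a b" "on_edge a b f" using assms by (auto simp: graph_ball_def cayley_points_iff)
  obtain u where u: "f u > 0" using on_edge_exists_pos[OF ab(2)] by blast
  then have uB: "u \<in> word_ball n" using assms by (auto simp: graph_ball_def)
  have "on_edge a b (vertex u)" using on_edge_support[OF ab(2), of u] u on_edge_vertex by auto
  then have "connectedin X (mix f (vertex u) ` {0..1})" "mix f (vertex u) ` {0..1} \<subseteq> graph_ball n"
    using connectedin_mix[OF ab] mix_in_graph_ball[OF ab] assms vertex_in_graph_ball[OF uB] by auto
  moreover obtain T where "connectedin X T" "T \<subseteq> graph_ball n" "vertex \<one> \<in> T" "vertex u \<in> T"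
    using vert[OF uB] by blast
  ultimately show ?thesis
    using connectedin_Un[of X T "mix f (vertex u) ` {0..1}"] mix_endpoints[of f "vertex u"]
      mix_endpoints[of "vertex u" f]
    by (intro exI[of _ "T \<union> mix f (vertex u) ` {0..1}"]) blast
qed

lemma connectedin_graph_ball: "connectedin X (graph_ball n)"
proof -
  let ?T = "{T. connectedin X T \<and> T \<subseteq> graph_ball n \<and> vertex \<one> \<in> T}"
  have "graph_ball n = \<Union>?T" using graph_ball_join by blast
  moreover have "connectedin X (\<Union>?T)" by (rule connectedin_Union) auto
  ultimately show ?thesis by simp
qed

lemma connected_X: "connected_space X"
proof -
  have "\<one> \<in> word_ball n" for n using word_ball_mono[of 0 n] by auto
  then have "vertex \<one> \<in> graph_ball n" for n by (rule vertex_in_graph_ball)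
  then have "connectedin X (\<Union>n. graph_ball n)"
    using connectedin_graph_ball by (intro connectedin_Union) auto
  then show ?thesis by (simp add: Union_graph_ball connectedin_topspace)
qed

lemma openin_X_box:
  assumes "openin X V" "f \<in> V"
  shows "\<exists>F \<epsilon>. finite F \<and> \<epsilon> > 0 \<and> {g \<in> cayley_points G H. \<forall>w\<in>F. \<bar>g w - f w\<bar> < \<epsilon>} \<subseteq> V"
proof -
  obtain W where W: "openin (product_topology (\<lambda>_. euclideanreal) UNIV) W" "V = W \<inter> cayley_points G H"
    using assms(1) unfolding cayley_graph_def openin_subtopology by blast
  then obtain A where A: "finite {i. A i \<noteq> UNIV}" "\<And>i. open (A i)" "f \<in> Pi\<^sub>E UNIV A" "Pi\<^sub>E UNIV A \<subseteq> W"
    using assms(2) unfolding openin_product_topology_alt by force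
  let ?F = "{i. A i \<noteq> UNIV}"
  have "\<exists>e>0. \<forall>x. \<bar>x - f i\<bar> < e \<longrightarrow> x \<in> A i" for i
  proof -
    have "f i \<in> A i" using A(3) by auto
    then show ?thesis using A(2)[of i] unfolding open_dist dist_real_def by blast
  qed
  then obtain e where e: "\<And>i. e i > 0" "\<And>i x. \<bar>x - f i\<bar> < e i \<Longrightarrow> x \<in> A i" by metis
  \<comment> \<open>The element 1 guards against the minimum of an empty set.\<close>
  define \<epsilon> where "\<epsilon> = Min (insert 1 (e ` ?F))"
  have "\<epsilon> > 0" using A(1) e(1) by (simp add: \<epsilon>_def)
  moreover have "{g \<in> cayley_points G H. \<forall>w\<in>?F. \<bar>g w - f w\<bar> < \<epsilon>} \<subseteq> V"
  proof
    fix g assume g: "g \<in> {g \<in> cayley_points G H. \<forall>w\<in>?F. \<bar>g w - f w\<bar> < \<epsilon>}"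
    have "g i \<in> A i" for i
    proof (cases "i \<in> ?F")
      case True
      then have "\<epsilon> \<le> e i" using A(1) by (auto simp: \<epsilon>_def)
      then show ?thesis using g True e(2)[of "g i" i] by auto
    qed simp
    then show "g \<in> V" using g A(4) W(2) by auto
  qed
  ultimately show ?thesis using A(1) by blast
qed

text \<open>Every point \<open>g\<close> whose coordinates are positive where those of \<open>f\<close> are lies on a common edge with
  \<open>f\<close>. If it is also close to \<open>f\<close> in the given finitely many coordinates, then so is the whole
  segment from \<open>f\<close> to \<open>g\<close>.\<close>

lemma locally_connected_X: "locally_connected_space X"
  unfolding locally_connected_space_im_kleinen
proof (intro allI impI)
  fix V f assume V: "openin X V \<and> f \<in> V"
  then obtain F \<epsilon> where F: "finite F" "\<epsilon> > 0" "{g \<in> cayley_points G H. \<forall>w\<in>F. \<bar>g w - f w\<bar> < \<epsilon>} \<subseteq> V"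
    using openin_X_box by blast
  have "f \<in> cayley_points G H" using V openin_subset topspace_X by blast
  then obtain u v where uv: "edge u v" "on_edge u v f" by (auto simp: cayley_points_iff)
  define P where "P = {w \<in> {u, v}. f w > 0}"
  define N where "N w = {g \<in> cayley_points G H. g w \<in> {f w - \<epsilon><..<f w + \<epsilon>}}" for w
  define Q where "Q w = {g \<in> cayley_points G H. g w \<in> {0<..}}" for w
  define U where "U = \<Inter>(insert (cayley_points G H) (N ` F \<union> Q ` P))"
  have opU: "openin X U"
    unfolding U_def
  proof (rule openin_Inter)
    have "finite P" unfolding P_def by simp
    then show "finite (insert (cayley_points G H) (N ` F \<union> Q ` P))" using F(1) by simp
    fix T assume "T \<in> insert (cayley_points G H) (N ` F \<union> Q ` P)"
    then consider "T = topspace X" | w where "T = N w" | w where "T = Q w" by (auto simp: topspace_X)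
    then show "openin X T"
      by cases (simp_all only: N_def Q_def openin_topspace openin_coordinate open_greaterThan open_greaterThanLessThan)
  qed simp
  have fU: "f \<in> U" using \<open>f \<in> cayley_points G H\<close> F(2) by (auto simp: U_def N_def Q_def P_def)
  have U_D: "g \<in> cayley_points G H" "w \<in> F \<Longrightarrow> \<bar>g w - f w\<bar> < \<epsilon>" "w \<in> P \<Longrightarrow> g w > 0"
    if g: "g \<in> U" for g w
  proof -
    show "g \<in> cayley_points G H" using g unfolding U_def by blast
    show "\<bar>g w - f w\<bar> < \<epsilon>" if "w \<in> F"
    proof -
      have "g \<in> N w" using g that unfolding U_def by blast
      then show ?thesis by (auto simp: N_def abs_less_iff)
    qed
    show "g w > 0" if "w \<in> P"
    proof -
      have "g \<in> Q w" using g that unfolding U_def by blast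
      then show ?thesis by (simp add: Q_def)
    qed
  qed
  have UV: "U \<subseteq> V" using F(3) U_D(1,2) by blast
  have "\<exists>C. connectedin X C \<and> C \<subseteq> V \<and> f \<in> C \<and> g \<in> C" if g: "g \<in> U" for g
  proof -
    obtain a b where ab: "edge a b" "on_edge a b g" using U_D(1)[OF g] by (auto simp: cayley_points_iff)
    have pos: "g w > 0" if "f w > 0" for w
      using that U_D(3)[OF g, of w] on_edge_support[OF uv(2), of w] by (auto simp: P_def)
    have "on_edge a b f"
    proof -
      have sub: "w = a \<or> w = b" if "f w \<noteq> 0" for w
        using pos[of w] on_edge_pos[OF uv(2) that] on_edge_support[OF ab(2), of w] by auto
      show ?thesis
      proof (cases "f u \<noteq> 0 \<and> f v \<noteq> 0")
        case True
        then show ?thesis using sub[of u] sub[of v] uv(2) on_edge_commute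
          by (cases "u = v")
            (use on_edge_vertex on_edge_degenerate in \<open>auto simp: on_edge_def sum.insert_if split: if_splits\<close>)
      next
        case False
        then obtain x where "f = vertex x" "f x \<noteq> 0"
          using on_edge_degenerate[OF uv(2)] on_edge_degenerate[of v u f] uv(2) on_edge_commute
          by (auto simp: vertex_def)
        then show ?thesis using sub[of x] on_edge_vertex by auto
      qed
    qed
    then have "connectedin X (mix f g ` {0..1})" using connectedin_mix ab by blast
    moreover have "mix f g ` {0..1} \<subseteq> V"
    proof
      fix k assume "k \<in> mix f g ` {0..1}"
      then obtain s where s: "0 \<le> s" "s \<le> 1" "k = mix f g s" by auto
      have "k \<in> cayley_points G H"
        using on_edge_mix[OF \<open>on_edge a b f\<close> ab(2)] s ab(1) cayley_points_iff by blast
      moreover have "\<bar>k w - f w\<bar> < \<epsilon>" if "w \<in> F" for w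
      proof -
        have "k w - f w = s * (g w - f w)" by (simp add: s mix_def algebra_simps)
        then have "\<bar>k w - f w\<bar> \<le> \<bar>g w - f w\<bar>" using s by (simp add: abs_mult mult_left_le_one_le)
        also have "\<dots> < \<epsilon>" using U_D(2)[OF g that] .
        finally show ?thesis .
      qed
      ultimately show "k \<in> V" using F(3) by blast
    qed
    ultimately show ?thesis using mix_endpoints[of f g] mix_endpoints[of g f] by blast
  qed
  then have cn: "\<forall>g\<in>U. \<exists>C. connectedin X C \<and> C \<subseteq> V \<and> f \<in> C \<and> g \<in> C" by simp
  show "\<exists>U. openin X U \<and> f \<in> U \<and> U \<subseteq> V \<and> (\<forall>y\<in>U. \<exists>C. connectedin X C \<and> C \<subseteq> V \<and> f \<in> C \<and> y \<in> C)"
    by (rule exI[of _ U]) (intro conjI opU fU UV cn)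
qed

sublocale cayley: exhausted_space X graph_ball
  by unfold_locales
    (simp_all add: Hausdorff_X locally_connected_X connected_X compactin_graph_ball Union_graph_ball
      graph_ball_subset_interior)

text \<open>The action of the group on its Cayley graph by left translations.\<close>

definition translate :: "'a \<Rightarrow> ('a \<Rightarrow> real) \<Rightarrow> 'a \<Rightarrow> real" where
  "translate a f = (\<lambda>w. if w \<in> carrier G then f (inv a \<otimes> w) else 0)"

lemma translate_at: "a \<in> carrier G \<Longrightarrow> x \<in> carrier G \<Longrightarrow> translate a f (a \<otimes> x) = f x"
  by (simp add: translate_def flip: m_assoc)

lemma translate_in_cayley_points:
  assumes a: "a \<in> carrier G" and f: "f \<in> cayley_points G H" shows "translate a f \<in> cayley_points G H"
proof -
  obtain u v where uv: "edge u v" "on_edge u v f" using f by (auto simp: cayley_points_iff)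
  then have c: "u \<in> carrier G" "v \<in> carrier G" by (auto simp: edge_def)
  have "edge (a \<otimes> u) (a \<otimes> v)"
  proof (cases "u = v")
    case False
    then obtain h where h: "h \<in> H" "u \<otimes> h = v" using uv(1) by (auto simp: edge_def cayley_adjacent_def)
    then have "(a \<otimes> u) \<otimes> h = a \<otimes> v" using a c H_props(2) by (metis m_assoc subsetD)
    then show ?thesis using a c h(1) by (auto simp: edge_def cayley_adjacent_def)
  qed (use a c in \<open>simp add: edge_def\<close>)
  moreover have "on_edge (a \<otimes> u) (a \<otimes> v) (translate a f)"
  proof -
    have "(\<Sum>w\<in>{a \<otimes> u, a \<otimes> v}. translate a f w) = (\<Sum>w\<in>{u, v}. f w)"
      using translate_at[OF a] c a by (cases "u = v") (auto simp: sum.insert_if)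
    moreover have "translate a f w = 0" if "w \<notin> {a \<otimes> u, a \<otimes> v}" for w
    proof (cases "w \<in> carrier G")
      case True
      then have "a \<otimes> (inv a \<otimes> w) = w" using a by (simp flip: m_assoc)
      then have "inv a \<otimes> w \<notin> {u, v}" using that by auto
      then show ?thesis using uv(2) by (simp add: translate_def on_edge_def)
    qed (simp add: translate_def)
    ultimately show ?thesis using uv(2) by (simp add: on_edge_def translate_def)
  qed
  ultimately show ?thesis by (auto simp: cayley_points_iff)
qed

lemma cayley_points_outside: "f \<in> cayley_points G H \<Longrightarrow> w \<notin> carrier G \<Longrightarrow> f w = 0"
  unfolding cayley_points_iff edge_def using on_edge_support by blast

lemma continuous_translate: "a \<in> carrier G \<Longrightarrow> continuous_map X X (translate a)"
proof (rule continuous_into_X)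
  show "continuous_map X euclideanreal (\<lambda>f. translate a f w)" for w
    by (cases "w \<in> carrier G") (simp_all add: translate_def continuous_coordinate)
qed (auto simp: topspace_X translate_in_cayley_points)

lemma homeomorphic_translate:
  assumes a: "a \<in> carrier G" shows "homeomorphic_map X X (translate a)"
proof -
  have inv: "translate (inv b) (translate b f) = f" if "f \<in> cayley_points G H" "b \<in> carrier G" for f b
  proof
    fix w
    show "translate (inv b) (translate b f) w = f w"
      using that cayley_points_outside[OF that(1), of w] by (auto simp: translate_def simp flip: m_assoc)
  qed
  have "homeomorphic_maps X X (translate a) (translate (inv a))"
    unfolding homeomorphic_maps_def
    using continuous_translate[OF a] continuous_translate[of "inv a"] inv[OF _ a] inv[of _ "inv a"] a
    by (auto simp: topspace_X)
  then show ?thesis using homeomorphic_map_maps by blast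
qed

text \<open>The unbounded component \<open>C\<close> contains a vertex \<open>u\<close> outside any given word ball. The translate by \<open>u\<close>
  of the ball of radius \<open>n\<close> contains that vertex, and it meets the ball of radius \<open>m\<close> only if \<open>u\<close> is
  of the form \<open>b \<otimes> inv c\<close> with \<open>b\<close> and \<open>c\<close> in the two word balls, which excludes but finitely many \<open>u\<close>.\<close>

lemma translate_graph_ball_away:
  assumes C: "C \<in> cayley.comps m" and unbounded: "\<nexists>L. compactin X L \<and> C \<subseteq> L"
  shows "\<exists>g. homeomorphic_map X X g \<and> g ` graph_ball n \<inter> graph_ball m = {} \<and> g ` graph_ball n \<inter> C \<noteq> {}"
proof -
  have car: "word_ball m \<subseteq> carrier G" "word_ball n \<subseteq> carrier G" by (rule word_ball_carrier)+
  let ?F = "word_ball m \<union> (\<lambda>(b, c). b \<otimes> inv c) ` (word_ball m \<times> word_ball n)"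
  have "finite ?F" by (simp add: word_ball_finite)
  moreover have "?F \<subseteq> carrier G" using car by auto
  ultimately obtain N where N: "?F \<subseteq> word_ball N" using finite_subset_word_ball by blast
  have "\<not> C \<subseteq> graph_ball N" using unbounded compactin_graph_ball by blast
  then obtain f where f: "f \<in> C" "f \<notin> graph_ball N" by blast
  have "f \<in> cayley_points G H" using f(1) openin_subset[OF cayley.openin_comps[OF C]] topspace_X by blast
  then obtain u where u: "f u \<noteq> 0" "u \<notin> word_ball N" using f(2) by (auto simp: graph_ball_def)
  obtain a b where ab: "edge a b" "on_edge a b f" using \<open>f \<in> cayley_points G H\<close> by (auto simp: cayley_points_iff)
  have uab: "u = a \<or> u = b" using on_edge_support[OF ab(2) u(1)] .
  then have uc: "u \<in> carrier G" using ab(1) by (auto simp: edge_def)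
  let ?M = "mix f (vertex u) ` {0..1}"
  have "on_edge a b (vertex u)" using uab on_edge_vertex by auto
  then have "connectedin X ?M" by (rule connectedin_mix[OF ab])
  moreover have "?M \<inter> graph_ball m = {}"
  proof -
    have "mix f (vertex u) s u > 0" if "0 \<le> s" "s \<le> 1" for s
    proof -
      have "f u > 0" using on_edge_pos[OF ab(2) u(1)] .
      then show ?thesis using that
        by (cases "s = 1") (auto simp: mix_def vertex_def intro: add_pos_nonneg)
    qed
    moreover have "u \<notin> word_ball m" using u(2) N by blast
    ultimately show ?thesis by (fastforce simp: graph_ball_def)
  qed
  moreover have "?M \<inter> C \<noteq> {}" using mix_endpoints(1)[of f "vertex u"] f(1) by blast
  ultimately have "?M \<subseteq> C" by (rule cayley.comps_maximal[OF C])
  then have uC: "vertex u \<in> C" using mix_endpoints(2)[of "vertex u" f] by blast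
  have "translate u (vertex \<one>) = vertex u"
  proof
    fix w
    have "inv u \<otimes> w = \<one> \<longleftrightarrow> w = u" if "w \<in> carrier G"
      using that uc by (metis inv_solve_left one_closed r_one)
    then show "translate u (vertex \<one>) w = vertex u w" using uc by (auto simp: translate_def vertex_def)
  qed
  moreover have "vertex \<one> \<in> graph_ball n"
    using word_ball_mono[of 0 n] by (intro vertex_in_graph_ball) auto
  ultimately have "vertex u \<in> translate u ` graph_ball n" by (metis imageI)
  moreover have "translate u ` graph_ball n \<inter> graph_ball m = {}"
  proof (rule ccontr)
    assume "translate u ` graph_ball n \<inter> graph_ball m \<noteq> {}"
    then obtain f' where f': "f' \<in> graph_ball n" "translate u f' \<in> graph_ball m" by blast
    then obtain w where w: "f' w > 0" using cayley_points_exists_pos[of f'] by (auto simp: graph_ball_def)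
    then have wn: "w \<in> word_ball n" using f'(1) by (auto simp: graph_ball_def)
    then have wc: "w \<in> carrier G" using car by blast
    have "translate u f' (u \<otimes> w) \<noteq> 0" using translate_at[OF uc wc] w by simp
    then have "u \<otimes> w \<in> word_ball m" using f'(2) by (auto simp: graph_ball_def)
    then have "(u \<otimes> w) \<otimes> inv w \<in> ?F" using wn by (intro UnI2 image_eqI[of _ _ "(u \<otimes> w, w)"]) auto
    moreover have "(u \<otimes> w) \<otimes> inv w = u" using uc wc by (simp add: m_assoc)
    ultimately show False using N u(2) by auto
  qed
  ultimately show ?thesis using homeomorphic_translate[OF uc] uC by (intro exI[of _ "translate u"]) blast
qed

lemma not_compact_X: "infinite (carrier G) \<Longrightarrow> \<not> compact_space X"
proof
  assume inf: "infinite (carrier G)" and "compact_space X"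
  then obtain n where n: "topspace X \<subseteq> graph_ball n"
    using cayley.compactin_subset_K unfolding compact_space_def by blast
  have "carrier G \<subseteq> word_ball n"
  proof
    fix u assume "u \<in> carrier G"
    then have "vertex u \<in> graph_ball n" using n vertex_in_cayley_points topspace_X by blast
    then show "u \<in> word_ball n" by (auto simp: graph_ball_def vertex_def)
  qed
  then show False using inf word_ball_finite finite_subset by blast
qed

end

section \<open>Surfaces\<close>

text \<open>Countably many open sets with compact closure cover the space. Take finite unions of them, with
  indices growing so fast that each union contains the closure of the one before.\<close>

lemma second_countable_exhaustion:
  assumes haus: "Hausdorff_space X" and sec: "second_countable X" and loc: "locally_compact_space X"
  shows "\<exists>K. (\<forall>n. compactin X (K n) \<and> K n \<subseteq> X interior_of K (Suc n)) \<and> (\<Union>n. K n) = topspace X"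
proof -
  obtain \<B> where \<B>: "countable \<B>" "\<And>V. V \<in> \<B> \<Longrightarrow> openin X V"
    "\<And>U x. openin X U \<Longrightarrow> x \<in> U \<Longrightarrow> \<exists>V\<in>\<B>. x \<in> V \<and> V \<subseteq> U"
    using sec unfolding second_countable_def by metis
  \<comment> \<open>The empty set is inserted only to make \<open>\<D>\<close> nonempty, so that it can be enumerated.\<close>
  define \<D> where "\<D> = insert {} {V \<in> \<B>. compactin X (X closure_of V)}"
  have \<D>: "countable \<D>" "\<D> \<noteq> {}" "\<And>V. V \<in> \<D> \<Longrightarrow> openin X V \<and> compactin X (X closure_of V)"
    using \<B>(1,2) by (auto simp: \<D>_def)
  have cover: "topspace X \<subseteq> \<Union>\<D>"
  proof
    fix x assume x: "x \<in> topspace X"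
    then obtain U C where U: "openin X U" "compactin X C" "x \<in> U" "U \<subseteq> C"
      using loc unfolding locally_compact_space_def by blast
    then obtain V where V: "V \<in> \<B>" "x \<in> V" "V \<subseteq> U" using \<B>(3) by blast
    have "closedin X C" by (rule compactin_imp_closedin[OF haus U(2)])
    then have "X closure_of V \<subseteq> C" using V(3) U(4) by (intro closure_of_minimal) auto
    then have "compactin X (X closure_of V)" using closed_compactin[OF U(2)] by simp
    then show "x \<in> \<Union>\<D>" using V by (auto simp: \<D>_def)
  qed
  define b where "b = from_nat_into \<D>"
  have b: "b i \<in> \<D>" for i unfolding b_def by (rule from_nat_into[OF \<D>(2)])
  have b_surj: "\<exists>i. b i = V" if "V \<in> \<D>" for V
    unfolding b_def using from_nat_into_surj[OF \<D>(1) that] .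
  define O' where "O' N = (\<Union>i<N. b i)" for N :: nat
  have opO: "openin X (O' N)" for N using \<D>(3)[OF b] by (auto simp: O'_def)
  have coO: "compactin X (X closure_of O' N)" for N
  proof -
    have "X closure_of O' N = (\<Union>i<N. X closure_of b i)"
      unfolding O'_def by (simp add: closure_of_Union image_image)
    then show ?thesis using \<D>(3)[OF b] by (auto intro!: compactin_Union)
  qed
  have monoO: "O' M \<subseteq> O' N" if "M \<le> N" for M N
    unfolding O'_def by (rule UN_mono) (use that in auto)
  have coverO: "topspace X \<subseteq> (\<Union>N. O' N)"
  proof
    fix x assume "x \<in> topspace X"
    then obtain V where "V \<in> \<D>" "x \<in> V" using cover by blast
    then obtain i where "x \<in> b i" using b_surj by metis
    then have "x \<in> O' (Suc i)" by (auto simp: O'_def)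
    then show "x \<in> (\<Union>N. O' N)" by blast
  qed
  have next_index: "\<exists>N. N > M \<and> X closure_of O' M \<subseteq> O' N" for M
  proof -
    have "X closure_of O' M \<subseteq> \<Union>(range O')" by (rule subset_trans[OF closure_of_subset_topspace coverO])
    moreover have "openin X W" if "W \<in> range O'" for W using opO that by fastforce
    ultimately obtain \<F> where \<F>: "finite \<F>" "\<F> \<subseteq> range O'" "X closure_of O' M \<subseteq> \<Union>\<F>"
      using compactinD[OF coO] by metis
    obtain I where I: "finite I" "\<F> = O' ` I" using finite_subset_image[OF \<F>(1,2)] by blast
    define N where "N = Max (insert (Suc M) I)"
    have "O' i \<subseteq> O' N" if "i \<in> I" for i using I(1) that by (intro monoO) (simp add: N_def)
    moreover have "N > M" using I(1) Max_ge[of "insert (Suc M) I" "Suc M"] by (simp add: N_def less_eq_Suc_le)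
    ultimately show ?thesis using \<F>(3) I(2) by blast
  qed
  then obtain s where s: "\<And>M. s M > M" "\<And>M. X closure_of O' M \<subseteq> O' (s M)" by metis
  define r where "r n = (s ^^ n) 0" for n
  have r: "r n < r (Suc n)" "X closure_of O' (r n) \<subseteq> O' (r (Suc n))" for n
    using s by (simp_all add: r_def)
  have le: "n \<le> r n" for n
  proof (induction n)
    case (Suc n) then show ?case using r(1)[of n] by simp
  qed simp
  have sub: "O' N \<subseteq> X closure_of O' N" for N by (rule closure_of_subset[OF openin_subset[OF opO]])
  have "topspace X \<subseteq> (\<Union>n. X closure_of O' (r n))"
  proof
    fix x assume "x \<in> topspace X"
    then obtain n where "x \<in> O' n" using coverO by blast
    then have "x \<in> X closure_of O' (r n)" using monoO[OF le[of n]] sub[of "r n"] by blast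
    then show "x \<in> (\<Union>n. X closure_of O' (r n))" by blast
  qed
  moreover have "X closure_of O' (r n) \<subseteq> X interior_of (X closure_of O' (r (Suc n)))" for n
    using r(2)[of n] interior_of_maximal[OF sub opO] by (rule subset_trans)
  moreover have "(\<Union>n. X closure_of O' (r n)) \<subseteq> topspace X" by (intro UN_least closure_of_subset_topspace)
  ultimately show ?thesis using coO by (intro exI[of _ "\<lambda>n. X closure_of O' (r n)"]) auto
qed

lemma locally_connected_euclidean: "locally_connected_space (euclidean :: 'b :: real_normed_vector topology)"
  unfolding locally_connected_space
proof (intro allI impI)
  fix V and x :: 'b assume "openin euclidean V \<and> x \<in> V"
  then obtain e where "e > 0" "ball x e \<subseteq> V" by (auto elim: openE)
  then show "\<exists>U. openin euclidean U \<and> connectedin euclidean U \<and> x \<in> U \<and> U \<subseteq> V"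
    by (intro exI[of _ "ball x e"]) auto
qed

lemma surface_locally:
  assumes "surface X"
  shows locally_compact_surface: "locally_compact_space X" and locally_connected_surface: "locally_connected_space X"
proof -
  have loc: "\<exists>U. openin X U \<and> x \<in> U \<and> locally_compact_space (subtopology X U) \<and>
      locally_connected_space (subtopology X U)" if x: "x \<in> topspace X" for x
  proof -
    obtain U V where U: "openin X U" "x \<in> U" "open (V :: complex set)"
      "subtopology X U homeomorphic_space top_of_set V"
      using assms x unfolding surface_def by blast
    have "locally_compact_space (top_of_set V)"
      using U(3) by (intro locally_compact_space_open_subset) (auto simp: locally_compact_space_euclidean)
    moreover have "locally_connected_space (top_of_set V)"
      using U(3) by (intro locally_connected_space_open_subset[OF locally_connected_euclidean]) simp
    ultimately show ?thesis
      using U homeomorphic_locally_compact_space homeomorphic_locally_connected_space by blast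
  qed
  show "locally_compact_space X"
    unfolding locally_compact_space_def
  proof
    fix x assume "x \<in> topspace X"
    then obtain U where U: "openin X U" "x \<in> U" "locally_compact_space (subtopology X U)" using loc by blast
    then have "x \<in> topspace (subtopology X U)" using openin_subset by auto
    then obtain W C where "openin (subtopology X U) W" "compactin (subtopology X U) C" "x \<in> W" "W \<subseteq> C"
      using U(3) unfolding locally_compact_space_def by blast
    then show "\<exists>W C. openin X W \<and> compactin X C \<and> x \<in> W \<and> W \<subseteq> C"
      using U(1) by (meson compactin_subtopology openin_trans_full)
  qed
  show "locally_connected_space X"
    unfolding locally_connected_space
  proof (intro allI impI)
    fix V x assume V: "openin X V \<and> x \<in> V"
    then have "x \<in> topspace X" using openin_subset by blast
    then obtain U where U: "openin X U" "x \<in> U" "locally_connected_space (subtopology X U)" using loc by blast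
    have "openin (subtopology X U) (U \<inter> V)" using V U(1) by (simp add: openin_subtopology_Int2)
    then obtain W where "openin (subtopology X U) W" "connectedin (subtopology X U) W" "x \<in> W" "W \<subseteq> U \<inter> V"
      using U(2,3) V unfolding locally_connected_space by (metis IntI)
    then show "\<exists>W. openin X W \<and> connectedin X W \<and> x \<in> W \<and> W \<subseteq> V"
      using U(1) by (metis connectedin_subtopology le_inf_iff openin_trans_full)
  qed
qed

lemma surface_exhausted:
  assumes "surface X" shows "\<exists>K. exhausted_space X K"
proof -
  have "Hausdorff_space X" "second_countable X" "connected_space X" using assms by (auto simp: surface_def)
  moreover obtain K where "\<forall>n. compactin X (K n) \<and> K n \<subseteq> X interior_of K (Suc n)" "(\<Union>n. K n) = topspace X"
    using second_countable_exhaustion[OF calculation(1,2) locally_compact_surface[OF assms]] by auto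
  ultimately show ?thesis using locally_connected_surface[OF assms]
    by (intro exI[of _ K]) (simp add: exhausted_space_def)
qed

section \<open>The ends of the translation surface\<close>

lemma isolated_in_countable_discrete_dense_open:
  assumes "countable_discrete_dense_open Y U" "u \<in> U" shows "openin Y {u}"
proof -
  have "openin (subtopology Y U) {u}" "openin Y U"
    using assms by (auto simp: countable_discrete_dense_open_def)
  then show ?thesis using openin_trans_full by blast
qed

theorem corollary1:
  fixes G H :: "(real^2^2) set"
    and S :: "'a topology" and A :: "'a atlas"
    and B U :: "(nat \<Rightarrow> 'a set) set set"
  defines "EG \<equiv> group_ends_space (GL_plus\<lparr>carrier := G\<rparr>) H"
  assumes "subgroup G GL_plus"
    and "finite_generating_set (GL_plus\<lparr>carrier := G\<rparr>) H"
    and "infinite G"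
    and "\<forall>g\<in>G. \<not> contracting g"
    and "translation_surface S A"
    and "tame S A"
    and "veech_group S A = G"
    and "ends_infinite_genus S = ends S"
    and "ends S = B \<union> U" and "B \<inter> U = {}"
    and "closedin (ends_space S) B"
    and "subtopology (ends_space S) B homeomorphic_space EG"
    and "countable_discrete_dense_open (ends_space S) U"
  shows "(card (topspace EG) = 1 \<or> card (topspace EG) = 2 \<or> infinite (topspace EG)) \<and>
    (card (topspace EG) = 1 \<longrightarrow>
       ends_space S homeomorphic_space omega_plus_1 \<and>
       ends_space S homeomorphic_space harmonic_closure) \<and>
    (card (topspace EG) = 2 \<longrightarrow>
       ends_space S homeomorphic_space omega_times_2_plus_1 \<and>
       ends_space S homeomorphic_space sum_topology (\<lambda>_. harmonic_closure) (UNIV :: bool set)) \<and>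
    (infinite (topspace EG) \<longrightarrow>
       (\<exists>C \<subseteq> ends S.
          subtopology (ends_space S) C homeomorphic_space top_of_set cantor_set \<and>
          countable_discrete_dense_open (ends_space S) (ends S - C)))"
proof -
  let ?\<Gamma> = "GL_plus\<lparr>carrier := G\<rparr>"
  interpret \<Gamma>: finitely_generated_group ?\<Gamma> H
    using subgroup.subgroup_is_group[OF assms(2) group_GL_plus] assms(3)
    by (intro finitely_generated_group.intro) (simp_all add: finitely_generated_group_axioms_def)
  have EG: "EG = ends_space (cayley_graph ?\<Gamma> H)" by (simp add: EG_def group_ends_space_def)
  have "\<not> compact_space (cayley_graph ?\<Gamma> H)" using \<Gamma>.not_compact_X assms(4) by simp
  then have group_ends: "card (topspace EG) = 1 \<or> card (topspace EG) = 2 \<or>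
      infinite (topspace EG) \<and> EG homeomorphic_space top_of_set cantor_set"
    unfolding EG topspace_ends_space
    by (rule \<Gamma>.cayley.homogeneous_ends[OF _ \<Gamma>.connectedin_graph_ball \<Gamma>.translate_graph_ball_away])
  obtain K where "exhausted_space S K"
    using surface_exhausted[of S] assms(6) unfolding translation_surface_def by blast
  then have comp: "compact_space (ends_space S)" by (rule exhausted_space.compact_ends_space)
  have top: "topspace (ends_space S) = B \<union> U" using assms(10) by simp
  have iso: "\<And>u. u \<in> U \<Longrightarrow> openin (ends_space S) {u}"
    using isolated_in_countable_discrete_dense_open[OF assms(14)] .
  have U: "countable U" "B \<subseteq> ends_space S closure_of U"
    using assms(14) top by (auto simp: countable_discrete_dense_open_def)
  have "topspace (subtopology (ends_space S) B) = B" using top by auto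
  moreover obtain f where "homeomorphic_map (subtopology (ends_space S) B) EG f"
    using assms(13) unfolding homeomorphic_space by blast
  ultimately have "bij_betw f B (topspace EG)"
    unfolding bij_betw_def homeomorphic_eq_everything_map by simp
  then have card: "card B = card (topspace EG)" by (rule bij_betw_same_card)
  note models = comp Hausdorff_ends_space top assms(11)
  have one: "ends_space S homeomorphic_space omega_plus_1 \<and> ends_space S homeomorphic_space harmonic_closure"
    if "card (topspace EG) = 1"
    unfolding omega_plus_1_def
    using homeomorphic_ordinal_space[OF models _ _ U(1) iso U(2)]
      homeomorphic_harmonic_closure[OF models _ U(1) iso U(2)] that card by simp
  have two: "ends_space S homeomorphic_space omega_times_2_plus_1 \<and>
      ends_space S homeomorphic_space sum_topology (\<lambda>_. harmonic_closure) (UNIV :: bool set)"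
    if "card (topspace EG) = 2"
    unfolding omega_times_2_plus_1_def
    using homeomorphic_ordinal_space[OF models _ _ U(1) iso U(2)]
      homeomorphic_two_harmonic_closures[OF models _ U(1) iso U(2)] that card by simp
  have inf: "\<exists>C \<subseteq> ends S. subtopology (ends_space S) C homeomorphic_space top_of_set cantor_set \<and>
      countable_discrete_dense_open (ends_space S) (ends S - C)" if "infinite (topspace EG)"
  proof (intro exI[of _ B] conjI)
    show "B \<subseteq> ends S" using assms(10) by blast
    have "card (topspace EG) \<noteq> 1" "card (topspace EG) \<noteq> 2" using that by simp_all
    then have "EG homeomorphic_space top_of_set cantor_set" using group_ends by blast
    then show "subtopology (ends_space S) B homeomorphic_space top_of_set cantor_set"
      using assms(13) homeomorphic_space_trans by blast
    have "ends S - B = U" using assms(10,11) by blast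
    then show "countable_discrete_dense_open (ends_space S) (ends S - B)" using assms(14) by simp
  qed
  have "card (topspace EG) = 1 \<or> card (topspace EG) = 2 \<or> infinite (topspace EG)"
    using group_ends by (elim disjE conjE) simp_all
  then show ?thesis using one two inf by (intro conjI impI) simp_all
qed

end
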